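(* Let $F$ be a field of characteristic zero and let $V$ be a two-dimensional connected braided vector space of diagonal type over $F$ with basis $x_1,x_2$ and braiding $C(x_i\otimes x_j)=p_{i,j}\,x_j\otimes x_i$, where $p_{1,1}=p_{2,2}=-1$ (connectedness here means $p_{1,2}p_{2,1}\neq 1$). Let $m=\operatorname{ord}(p_{1,2}p_{2,1})\in\{2,3,\dots\}\cup\{\infty\}$. Define the subset $P_1$ of the Nichols algebra $\mathfrak B(V)$ as follows. If $m<\infty$ and $(-p_{1,2}^{-2}p_{2,1})^{m}=(-p_{1,2}p_{2,1}^{-2})^{m}=-1$, let $$P_1=\{p_{1,2}^{k+1}(x_1x_2)^{k+1}-p_{2,1}^{k+1}(x_2x_1)^{k+1},\ x_2(x_1x_2)^{k},\ (x_1x_2)^{k}x_1 : 0\le k<m\}\setminus\{p_{1,2}^{m}(x_1x_2)^{m}-p_{2,1}^{m}(x_2x_1)^{m}\};$$ otherwise let $$P_1=\{p_{1,2}^{k+1}(x_1x_2)^{k+1}-p_{2,1}^{k+1}(x_2x_1)^{k+1},\ x_2(x_1x_2)^{k},\ (x_1x_2)^{k}x_1 : 0\le k<m\}$$ (where $0\le k<\infty$ means $k$ ranges over all nonnegative integers). Then $P_1$ is a basis of the Nichols R-bicharacter algebra $\mathfrak L(V)_R$. Furthermore, if $m<\infty$, then $\dim \mathfrak L(V)_R=3m-1$ when $(-p_{1,2}^{-2}p_{2,1})^{m}=(-p_{1,2}p_{2,1}^{-2})^{m}=-1$, and $\dim\mathfrak L(V)_R=3m$ otherwise.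
   Context: $\mathfrak B(V)$ denotes the Nichols algebra of $(V,C)$: the quotient of the tensor algebra $T(V)$ by the ideal $\bigoplus_{m\ge2}\ker S_m$ of kernels of the quantum symmetrizers. It is $\mathbb Z^2$-graded with $\deg x_i=e_i$. For homogeneous $u,v$ with $\deg u=a_1e_1+a_2e_2$, $\deg v=b_1e_1+b_2e_2$ put $p_{u,v}=\prod_{i,j}p_{i,j}^{a_ib_j}$ (a bicharacter). The R-bracket is $[u,v]_R=p_{u,v}uv-p_{v,u}vu$ for homogeneous $u,v$, extended bilinearly; it is a Lie bracket on $\mathfrak B(V)$ (the commutator of the associative product $u\circ v=p_{u,v}uv$). $\mathfrak L(V)_R$ is the Lie subalgebra of $(\mathfrak B(V),[\cdot,\cdot]_R)$ generated by $V$. $\operatorname{ord}(q)$ is the multiplicative order of $q\in F^*$ ($\infty$ if $q$ is not a root of unity). *)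

theory Defs
  imports Main "HOL-Combinatorics.Permutations" "HOL-Library.Function_Algebras" "HOL-Library.Extended_Nat"
begin

text \<open>Tensor algebra T(V) of V = span(x1,x2): elements are coefficient functions on words
  (lists of letters; the letters used are 1 and 2, x_i is the word [i]).  We work inside the
  ambient F-vector space nat list => F (pointwise operations); T(V) is the subspace of
  finitely supported functions on words in {1,2}.\<close>

type_synonym 'a tens = "nat list \<Rightarrow> 'a"

definition sc :: "'a::field \<Rightarrow> 'a tens \<Rightarrow> 'a tens" where
  "sc c u = (\<lambda>w. c * u w)"

definition word :: "nat list \<Rightarrow> 'a::field tens" where
  "word v = (\<lambda>w. if w = v then 1 else 0)"

definition tmul :: "'a::field tens \<Rightarrow> 'a tens \<Rightarrow> 'a tens" where
  "tmul u v = (\<lambda>w. \<Sum>k\<le>length w. u (take k w) * v (drop k w))"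

definition bichar :: "(nat \<Rightarrow> nat \<Rightarrow> 'a::field) \<Rightarrow> nat list \<Rightarrow> nat list \<Rightarrow> 'a" where
  "bichar p u v = prod_list (map (\<lambda>a. prod_list (map (\<lambda>b. p a b) v)) u)"

text \<open>R-bracket [u,v]_R = p_{u,v} uv - p_{v,u} vu on words, extended bilinearly.\<close>
definition rbr :: "(nat \<Rightarrow> nat \<Rightarrow> 'a::field) \<Rightarrow> 'a tens \<Rightarrow> 'a tens \<Rightarrow> 'a tens" where
  "rbr p u v = (\<lambda>w. \<Sum>k\<le>length w. bichar p (take k w) (drop k w) *
       (u (take k w) * v (drop k w) - v (take k w) * u (drop k w)))"

text \<open>Quantum symmetrizer S = sum_m S_m, S_m = sum over sigma in S_m of the Matsumoto lift
  T_sigma, which for a diagonal braiding is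
  T_sigma(x_{i_0}...x_{i_{n-1}}) = (prod over inversions a<b, sigma a > sigma b, of p_{i_a,i_b})
  x_{i_{sigma^-1 0}} ... x_{i_{sigma^-1 (n-1)}}.
  Coefficient of the output word w' (length n): the input word is w = w' o sigma.\<close>
definition qsym :: "(nat \<Rightarrow> nat \<Rightarrow> 'a::field) \<Rightarrow> 'a tens \<Rightarrow> 'a tens" where
  "qsym p u = (\<lambda>w'. let n = length w' in
     \<Sum>\<sigma>\<in>{\<sigma>. \<sigma> permutes {..<n}}.
       (\<Prod>(a,b)\<in>{(a,b). a < b \<and> b < n \<and> \<sigma> b < \<sigma> a}. p (w' ! \<sigma> a) (w' ! \<sigma> b))
       * u (map (\<lambda>a. w' ! \<sigma> a) [0..<n]))"

text \<open>The Nichols algebra B(V) = T(V) / (sum_{m>=2} ker S_m).  Since S is graded, this ideal is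
  the kernel of qsym on T(V), and u + I \<mapsto> qsym p u identifies B(V) linearly with the image
  of qsym.  The class of u in B(V) is represented by nichols p u.\<close>
abbreviation nichols :: "(nat \<Rightarrow> nat \<Rightarrow> 'a::field) \<Rightarrow> 'a tens \<Rightarrow> 'a tens" where
  "nichols p u \<equiv> qsym p u"

inductive_set lie_gen :: "(nat \<Rightarrow> nat \<Rightarrow> 'a::field) \<Rightarrow> 'a tens set" for p where
  gen: "i \<in> {1, 2} \<Longrightarrow> word [i] \<in> lie_gen p"
| add: "u \<in> lie_gen p \<Longrightarrow> v \<in> lie_gen p \<Longrightarrow> u + v \<in> lie_gen p"
| smult: "u \<in> lie_gen p \<Longrightarrow> sc c u \<in> lie_gen p"
| bracket: "u \<in> lie_gen p \<Longrightarrow> v \<in> lie_gen p \<Longrightarrow> rbr p u v \<in> lie_gen p"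

definition nichols_lie :: "(nat \<Rightarrow> nat \<Rightarrow> 'a::field) \<Rightarrow> 'a tens set" where
  "nichols_lie p = nichols p ` lie_gen p"

definition mord :: "'a::field \<Rightarrow> enat" where
  "mord q = (if \<exists>n>0. q ^ n = 1 then enat (LEAST n. n > 0 \<and> q ^ n = 1) else \<infinity>)"

definition elA :: "(nat \<Rightarrow> nat \<Rightarrow> 'a::field) \<Rightarrow> nat \<Rightarrow> 'a tens" where
  "elA p k = sc (p 1 2 ^ (k+1)) (word (concat (replicate (k+1) [1,2])))
             - sc (p 2 1 ^ (k+1)) (word (concat (replicate (k+1) [2,1])))"

definition elB :: "nat \<Rightarrow> 'a::field tens" where
  "elB k = word ([2] @ concat (replicate k [1,2]))"

definition elC :: "nat \<Rightarrow> 'a::field tens" where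
  "elC k = word (concat (replicate k [1,2]) @ [1])"

definition P1_full :: "(nat \<Rightarrow> nat \<Rightarrow> 'a::field) \<Rightarrow> enat \<Rightarrow> 'a tens set" where
  "P1_full p m = nichols p ` (\<Union>k\<in>{k. enat k < m}. {elA p k, elB k, elC k})"

definition exceptional :: "(nat \<Rightarrow> nat \<Rightarrow> 'a::field) \<Rightarrow> bool" where
  "exceptional p \<longleftrightarrow> (\<exists>m. mord (p 1 2 * p 2 1) = enat m \<and>
      (- (inverse (p 1 2) ^ 2 * p 2 1)) ^ m = -1 \<and> (- (p 1 2 * inverse (p 2 1) ^ 2)) ^ m = -1)"

definition P1 :: "(nat \<Rightarrow> nat \<Rightarrow> 'a::field) \<Rightarrow> 'a tens set" where
  "P1 p = (let m = mord (p 1 2 * p 2 1) in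
     if exceptional p then P1_full p m - {nichols p (elA p (the_enat m - 1))}
     else P1_full p m)"

end

theory Submission
  imports Defs
begin

text \<open>Since \<open>p\<^sub>1\<^sub>1 = p\<^sub>2\<^sub>2 = -1\<close>, every word with a repeated adjacent letter vanishes in the
  Nichols algebra, so only the two alternating words of each length matter.  The quantum symmetrizer
  factors through skew derivations, and on an alternating word only the removal of the first and of
  the last letter survives.  This gives a recursion with scalar factors \<open>1 - q\<^sup>k\<close>, where
  \<open>q = p\<^sub>1\<^sub>2 p\<^sub>2\<^sub>1\<close>, in odd degrees and two linear conditions in even degrees; the exceptional case is
  the one where both conditions hold for the last element \<open>A\<^bsub>m-1\<^esub>\<close>.  Modulo words with repeated letters
  the brackets are \<open>[C\<^sub>j, B\<^sub>k] \<sim> A\<^bsub>j+k\<^esub>\<close>, \<open>[A\<^sub>j, C\<^sub>k] \<sim> C\<^bsub>j+k+1\<^esub>\<close>, \<open>[A\<^sub>j, B\<^sub>k] \<sim> B\<^bsub>j+k+1\<^esub>\<close> up to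
  nonzero scalars and the others vanish.  Linear independence holds because the surviving elements
  are nonzero of distinct bidegrees.\<close>

declare One_nat_def [simp del]

section \<open>Skew derivations\<close>

text \<open>The right skew derivation for \<open>x\<close>, written on coefficients: an occurrence
  of \<open>x\<close> is braided to the end of the word, with a factor \<open>p x y\<close> for each
  letter \<open>y\<close> it passes, and cut off there.\<close>

definition skew_der :: "(nat \<Rightarrow> nat \<Rightarrow> 'a::field) \<Rightarrow> nat \<Rightarrow> 'a tens \<Rightarrow> 'a tens" where
  "skew_der p x u = (\<lambda>v. \<Sum>j\<le>length v. bichar p [x] (drop j v) * u (take j v @ x # drop j v))"

section \<open>Inserting and removing the largest value of a permutation\<close>

definition inversions :: "nat \<Rightarrow> (nat \<Rightarrow> nat) \<Rightarrow> (nat \<times> nat) set" where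
  "inversions n \<sigma> = {(a,b). a < b \<and> b < n \<and> \<sigma> b < \<sigma> a}"

text \<open>In one-line notation the new largest value \<open>n\<close> is inserted at position
  \<open>j\<close>. Points beyond \<open>n\<close> stay fixed, as \<open>permutes\<close>
  demands.\<close>

definition insert_max :: "nat \<Rightarrow> nat \<Rightarrow> (nat \<Rightarrow> nat) \<Rightarrow> nat \<Rightarrow> nat" where
  "insert_max n j \<tau> i = (if i < j then \<tau> i else if i = j then n else if i \<le> n then \<tau> (i - 1) else i)"

definition delete_max :: "nat \<Rightarrow> nat \<Rightarrow> (nat \<Rightarrow> nat) \<Rightarrow> nat \<Rightarrow> nat" where
  "delete_max n j \<sigma> i = (if i < j then \<sigma> i else if i < n then \<sigma> (Suc i) else i)"

lemma qsym_eq: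
  "qsym p u w = (\<Sum>\<sigma> | \<sigma> permutes {..<length w}.
      (\<Prod>(a,b)\<in>inversions (length w) \<sigma>. p (w ! \<sigma> a) (w ! \<sigma> b)) * u (map (\<lambda>a. w ! \<sigma> a) [0..<length w]))"
  by (simp add: qsym_def inversions_def Let_def)

lemma finite_inversions: "finite (inversions n \<sigma>)"
  by (rule finite_subset[of _ "{..<n} \<times> {..<n}"]) (auto simp: inversions_def)

lemma permutes_lessThanI:
  assumes "\<And>i. i < n \<Longrightarrow> f i < n" "\<And>i j. i < n \<Longrightarrow> j < n \<Longrightarrow> f i = f j \<Longrightarrow> i = j"
    "\<And>i. \<not> i < n \<Longrightarrow> f i = i"
  shows "f permutes {..<n::nat}"
proof (rule inj_imp_permutes)
  show "inj_on f {..<n}" using assms(2) by (blast intro: inj_onI)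
  show "f i \<in> {..<n}" if "i \<in> {..<n}" for i using assms(1)[of i] that by simp
  show "f i = i" if "i \<notin> {..<n}" for i using assms(3)[of i] that by simp
qed simp

lemma permutes_lessThanD:
  assumes "f permutes {..<n::nat}"
  shows "i < n \<Longrightarrow> f i < n" "f i = f j \<longleftrightarrow> i = j" "\<not> i < n \<Longrightarrow> f i = i"
  using permutes_in_image[OF assms, of i] permutes_inj[OF assms] permutes_not_in[OF assms, of i]
  by (auto dest: injD)

lemma insert_max_permutes:
  assumes "j \<le> n" "\<tau> permutes {..<n}"
  shows "insert_max n j \<tau> permutes {..<Suc n}"
proof (rule permutes_lessThanI)
  note t = permutes_lessThanD[OF assms(2)]
  have lt: "\<tau> i \<noteq> n" if "i < n" for i using t(1)[OF that] by simp
  show "insert_max n j \<tau> i < Suc n" if "i < Suc n" for i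
  proof -
    have "i < j \<Longrightarrow> \<tau> i < n" "j < i \<Longrightarrow> \<tau> (i - 1) < n"
      using that assms(1) by (auto intro!: t(1))
    thus ?thesis using that by (auto simp: insert_max_def less_Suc_eq)
  qed
  show "i = k" if "i < Suc n" "k < Suc n" "insert_max n j \<tau> i = insert_max n j \<tau> k" for i k
  proof -
    have "i < j \<Longrightarrow> \<tau> i \<noteq> n" "j < i \<Longrightarrow> \<tau> (i - 1) \<noteq> n"
      "k < j \<Longrightarrow> \<tau> k \<noteq> n" "j < k \<Longrightarrow> \<tau> (k - 1) \<noteq> n"
      using that assms(1) by (auto intro!: lt)
    thus ?thesis using that t(2) by (auto simp: insert_max_def split: if_splits)
  qed
  show "insert_max n j \<tau> i = i" if "\<not> i < Suc n" for i
    using that assms(1) by (auto simp: insert_max_def)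
qed

lemma delete_max_permutes:
  assumes "\<sigma> permutes {..<Suc n}" "\<sigma> j = n"
  shows "delete_max n j \<sigma> permutes {..<n}"
proof (rule permutes_lessThanI)
  note t = permutes_lessThanD[OF assms(1)]
  have jn: "j \<le> n" using t(3)[of j] assms(2) by (cases "j < Suc n") auto
  have lt: "\<sigma> i < n" if "i < Suc n" "i \<noteq> j" for i
    using t(1)[OF that(1)] t(2)[of i j] that assms(2) by auto
  show "delete_max n j \<sigma> i < n" if "i < n" for i
    using that jn lt[of i] lt[of "Suc i"] by (auto simp: delete_max_def)
  show "i = k" if "i < n" "k < n" "delete_max n j \<sigma> i = delete_max n j \<sigma> k" for i k
    using that t(2) by (auto simp: delete_max_def split: if_splits)
  show "delete_max n j \<sigma> i = i" if "\<not> i < n" for i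
    using that jn by (auto simp: delete_max_def)
qed

text \<open>The inserted value is the largest, so it forms an inversion with every later position
  and with no earlier one; \<open>sh\<close> renumbers the old positions around the gap
  \<open>j\<close>.\<close>

lemma inversions_insert_max:
  assumes "j \<le> n" "\<tau> permutes {..<n}"
  defines "sh \<equiv> (\<lambda>i. if i < j then i else Suc i)"
  shows "inversions (Suc n) (insert_max n j \<tau>)
    = (\<lambda>(a,b). (sh a, sh b)) ` inversions n \<tau> \<union> Pair j ` {Suc j..<Suc n}" (is "?L = ?R")
proof (intro equalityI subsetI)
  note t = permutes_lessThanD[OF assms(2)]
  have sh: "insert_max n j \<tau> (sh i) = \<tau> i" if "i < n" for i
    using that by (auto simp: sh_def insert_max_def)
  have ij: "insert_max n j \<tau> j = n" by (simp add: insert_max_def)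
  have surj: "\<exists>i<n. b = sh i" if "b < Suc n" "b \<noteq> j" for b
  proof (cases "b < j")
    case True thus ?thesis using assms(1) by (intro exI[of _ b]) (auto simp: sh_def)
  next
    case False thus ?thesis using that by (intro exI[of _ "b - 1"]) (auto simp: sh_def)
  qed
  have mono: "sh a < sh b \<longleftrightarrow> a < b" for a b by (auto simp: sh_def)
  have less: "sh b < Suc n" if "b < n" for b using that by (auto simp: sh_def)
  {
    fix z assume "z \<in> ?L"
    then obtain a b where z: "z = (a,b)" and ab: "a < b" "b < Suc n"
      "insert_max n j \<tau> b < insert_max n j \<tau> a" by (auto simp: inversions_def)
    have bj: "b \<noteq> j"
    proof
      assume "b = j"
      hence "a < n" using ab by simp
      hence "\<exists>i<n. a = sh i" using surj[of a] ab \<open>b = j\<close> by simp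
      thus False using ab(3) sh t(1) ij \<open>b = j\<close> by force
    qed
    then obtain b' where b': "b' < n" "b = sh b'" using surj ab by blast
    show "z \<in> ?R"
    proof (cases "a = j")
      case True thus ?thesis using z ab by auto
    next
      case False
      then obtain a' where a': "a' < n" "a = sh a'" using surj[of a] ab by auto
      hence "(a', b') \<in> inversions n \<tau>"
        using ab b' sh mono by (auto simp: inversions_def)
      thus ?thesis using z a' b' by force
    qed
  next
    fix z assume "z \<in> ?R"
    thus "z \<in> ?L"
    proof
      assume "z \<in> (\<lambda>(a,b). (sh a, sh b)) ` inversions n \<tau>"
      then obtain a b where "z = (sh a, sh b)" "a < b" "b < n" "\<tau> b < \<tau> a"
        by (auto simp: inversions_def)
      thus ?thesis using sh[of a] sh[of b] mono less by (auto simp: inversions_def)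
    next
      assume "z \<in> Pair j ` {Suc j..<Suc n}"
      then obtain b where b: "z = (j,b)" "j < b" "b < Suc n" by auto
      then obtain b' where b': "b' < n" "b = sh b'" using surj[of b] by auto
      show ?thesis using b b' sh t(1)[of b'] ij by (auto simp: inversions_def)
    qed
  }
qed

lemma map_insert_max:
  assumes "j \<le> length w" "\<tau> permutes {..<length w}"
  defines "v \<equiv> map (\<lambda>a. w ! \<tau> a) [0..<length w]"
  shows "map (\<lambda>a. (w @ [x]) ! insert_max (length w) j \<tau> a) [0..<Suc (length w)]
    = take j v @ x # drop j v"
proof (rule nth_equalityI)
  show "length (map (\<lambda>a. (w @ [x]) ! insert_max (length w) j \<tau> a) [0..<Suc (length w)])
      = length (take j v @ x # drop j v)" using assms by simp
next
  note t = permutes_lessThanD[OF assms(2)]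
  fix i assume "i < length (map (\<lambda>a. (w @ [x]) ! insert_max (length w) j \<tau> a) [0..<Suc (length w)])"
  hence i: "i < Suc (length w)" by simp
  consider "i < j" | "i = j" | "j < i" by linarith
  thus "map (\<lambda>a. (w @ [x]) ! insert_max (length w) j \<tau> a) [0..<Suc (length w)] ! i
      = (take j v @ x # drop j v) ! i"
  proof cases
    case 1 thus ?thesis using i assms(1) t(1)[of i]
      by (simp add: insert_max_def nth_append v_def del: upt_Suc)
  next
    case 2 thus ?thesis using i assms(1)
      by (simp add: insert_max_def nth_append v_def del: upt_Suc)
  next
    case 3
    then obtain k where k: "i = Suc k" by (cases i) auto
    show ?thesis using 3 i assms(1) t(1)[of k] unfolding k
      by (simp add: insert_max_def nth_append v_def Suc_diff_le del: upt_Suc)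
  qed
qed

lemma prod_list_map_upt: "prod_list (map f [a..<b]) = prod f {a..<b}" for f :: "nat \<Rightarrow> 'a::comm_monoid_mult"
  using prod.distinct_set_conv_list[of "[a..<b]" f] by simp

text \<open>Old inversions keep their weight. Those of the inserted value pair \<open>x\<close> with
  each letter behind position \<open>j\<close>, which is the bicharacter factor of
  \<open>skew_der\<close>.\<close>

lemma weight_insert_max:
  assumes "j \<le> length w" "\<tau> permutes {..<length w}"
  shows "(\<Prod>(a,b)\<in>inversions (Suc (length w)) (insert_max (length w) j \<tau>).
        p ((w @ [x]) ! insert_max (length w) j \<tau> a) ((w @ [x]) ! insert_max (length w) j \<tau> b))
    = bichar p [x] (drop j (map (\<lambda>a. w ! \<tau> a) [0..<length w]))
       * (\<Prod>(a,b)\<in>inversions (length w) \<tau>. p (w ! \<tau> a) (w ! \<tau> b))"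
    (is "?L = _")
proof -
  note t = permutes_lessThanD[OF assms(2)]
  let ?n = "length w"
  define sh where "sh = (\<lambda>i. if i < j then i else Suc i)"
  define F where "F = (\<lambda>(a,b). p ((w @ [x]) ! insert_max ?n j \<tau> a) ((w @ [x]) ! insert_max ?n j \<tau> b))"
  have sh: "insert_max ?n j \<tau> (sh i) = \<tau> i" if "i < ?n" for i
    using that by (auto simp: sh_def insert_max_def)
  have shj: "sh i \<noteq> j" for i by (auto simp: sh_def)
  have inj: "inj_on (\<lambda>(a,b). (sh a, sh b)) A" for A
    by (auto simp: inj_on_def sh_def split: if_splits)
  have "inversions (Suc ?n) (insert_max ?n j \<tau>)
      = (\<lambda>(a,b). (sh a, sh b)) ` inversions ?n \<tau> \<union> Pair j ` {Suc j..<Suc ?n}"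
    unfolding sh_def by (rule inversions_insert_max[OF assms])
  hence "?L = prod F ((\<lambda>(a,b). (sh a, sh b)) ` inversions ?n \<tau>) * prod F (Pair j ` {Suc j..<Suc ?n})"
    unfolding F_def
    by (simp only:, intro prod.union_disjoint) (use shj in \<open>auto simp: finite_inversions\<close>)
  also have "prod F ((\<lambda>(a,b). (sh a, sh b)) ` inversions ?n \<tau>)
      = (\<Prod>(a,b)\<in>inversions ?n \<tau>. p (w ! \<tau> a) (w ! \<tau> b))"
    by (subst prod.reindex[OF inj], rule prod.cong)
      (auto simp: F_def sh t(1) inversions_def nth_append)
  also have "prod F (Pair j ` {Suc j..<Suc ?n}) = (\<Prod>b\<in>{Suc j..<Suc ?n}. F (j, b))"
    by (subst prod.reindex) (auto simp: inj_on_def)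
  also have "\<dots> = (\<Prod>b\<in>{j..<?n}. F (j, Suc b))"
    by (rule prod.shift_bounds_Suc_ivl)
  also have "\<dots> = (\<Prod>b\<in>{j..<?n}. p x (w ! \<tau> b))"
    by (rule prod.cong) (auto simp: F_def insert_max_def nth_append t(1))
  also have "\<dots> = bichar p [x] (drop j (map (\<lambda>a. w ! \<tau> a) [0..<?n]))"
    by (simp add: bichar_def drop_map comp_def prod_list_map_upt)
  finally show ?thesis by (simp add: mult.commute)
qed

text \<open>The factorisation of the quantum symmetrizer through \<open>S\<^sub>n \<otimes> id\<close>: split a permutation by the
  position \<open>j\<close> from which the last output letter comes.\<close>
lemma qsym_snoc: "qsym p u (w @ [x]) = qsym p (skew_der p x u) w"
proof -
  let ?n = "length w"
  let ?v = "\<lambda>\<tau>. map (\<lambda>a. w ! \<tau> a) [0..<?n]"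
  let ?P = "\<lambda>\<tau>. \<Prod>(a,b)\<in>inversions ?n \<tau>. p (w ! \<tau> a) (w ! \<tau> b)"
  have "qsym p u (w @ [x]) = (\<Sum>\<sigma> | \<sigma> permutes {..<Suc ?n}.
      (\<Prod>(a,b)\<in>inversions (Suc ?n) \<sigma>. p ((w @ [x]) ! \<sigma> a) ((w @ [x]) ! \<sigma> b))
       * u (map (\<lambda>a. (w @ [x]) ! \<sigma> a) [0..<Suc ?n]))"
    by (simp add: qsym_eq del: upt_Suc)
  also have "\<dots> = (\<Sum>(\<tau>, j) \<in> {\<tau>. \<tau> permutes {..<?n}} \<times> {..?n}.
      ?P \<tau> * (bichar p [x] (drop j (?v \<tau>)) * u (take j (?v \<tau>) @ x # drop j (?v \<tau>))))"
  \<comment> \<open>Here \<open>j\<close> is the position that \<open>\<sigma>\<close> sends to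
    \<open>length w\<close>. Goals 1 to 4 are the bijection, goal 5 is the equality of
    summands.\<close>
  proof (rule sum.reindex_bij_witness[where i = "\<lambda>(\<tau>, j). insert_max ?n j \<tau>"
        and j = "\<lambda>\<sigma>. (delete_max ?n (inv \<sigma> ?n) \<sigma>, inv \<sigma> ?n)"], goal_cases)
    case (1 \<sigma>)
    hence s: "\<sigma> permutes {..<Suc ?n}" by simp
    note t = permutes_lessThanD[OF s]
    have j: "\<sigma> (inv \<sigma> ?n) = ?n" using permutes_inverses(1)[OF s] .
    have "inv \<sigma> ?n \<le> ?n" using t(3)[of "inv \<sigma> ?n"] j by (cases "inv \<sigma> ?n < Suc ?n") auto
    thus ?case using j t(3) by (auto simp: insert_max_def delete_max_def fun_eq_iff)
  next
    case (2 \<sigma>)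
    hence s: "\<sigma> permutes {..<Suc ?n}" by simp
    note t = permutes_lessThanD[OF s]
    have j: "\<sigma> (inv \<sigma> ?n) = ?n" using permutes_inverses(1)[OF s] .
    have "inv \<sigma> ?n \<le> ?n" using t(3)[of "inv \<sigma> ?n"] j by (cases "inv \<sigma> ?n < Suc ?n") auto
    thus ?case using delete_max_permutes[OF s j] by auto
  next
    case (3 z)
    then obtain \<tau> j where z: "z = (\<tau>, j)" "\<tau> permutes {..<?n}" "j \<le> ?n" by auto
    note t = permutes_lessThanD[OF z(2)]
    have s: "insert_max ?n j \<tau> permutes {..<Suc ?n}" by (rule insert_max_permutes[OF z(3,2)])
    have "insert_max ?n j \<tau> j = ?n" by (simp add: insert_max_def)
    hence j: "inv (insert_max ?n j \<tau>) ?n = j" using permutes_inverses(2)[OF s, of j] by simp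
    show ?case using z t(3) by (auto simp: j insert_max_def delete_max_def fun_eq_iff)
  next
    case (4 z)
    thus ?case using insert_max_permutes by auto
  next
    case (5 \<sigma>)
    hence s: "\<sigma> permutes {..<Suc ?n}" by simp
    note t = permutes_lessThanD[OF s]
    define j where "j = inv \<sigma> ?n"
    define \<tau> where "\<tau> = delete_max ?n j \<sigma>"
    have j: "\<sigma> j = ?n" unfolding j_def using permutes_inverses(1)[OF s] .
    have jn: "j \<le> ?n" using t(3)[of j] j by (cases "j < Suc ?n") auto
    have tp: "\<tau> permutes {..<?n}" unfolding \<tau>_def by (rule delete_max_permutes[OF s j])
    have st: "\<sigma> = insert_max ?n j \<tau>"
      using j jn t(3) by (auto simp: insert_max_def delete_max_def fun_eq_iff \<tau>_def)
    show ?case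
      unfolding j_def[symmetric] \<tau>_def[symmetric] prod.case
      by (simp only: st weight_insert_max[OF jn tp] map_insert_max[OF jn tp]) (simp only: mult_ac)
  qed
  also have "\<dots> = qsym p (skew_der p x u) w"
    by (simp add: sum.cartesian_product[symmetric] qsym_eq skew_der_def sum_distrib_left)
  finally show ?thesis .
qed

lemma qsym_Nil: "qsym p u [] = u []"
  by (simp add: qsym_def)

section \<open>Reduction to alternating words\<close>

definition alternating :: "nat list \<Rightarrow> bool" where
  "alternating w \<longleftrightarrow> set w \<subseteq> {1,2} \<and> distinct_adj w"

text \<open>Equality modulo words with a repeated adjacent letter, which are zero in the Nichols
  algebra; the bracket relations are read modulo these words.\<close>

definition agree_alternating :: "'a tens \<Rightarrow> 'a tens \<Rightarrow> bool" where
  "agree_alternating u v \<longleftrightarrow> (\<forall>w. alternating w \<longrightarrow> u w = v w)"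

definition tensor_supported :: "'a::zero tens \<Rightarrow> bool" where
  "tensor_supported u \<longleftrightarrow> (\<forall>w. u w \<noteq> 0 \<longrightarrow> set w \<subseteq> {1,2})"

text \<open>Together with \<open>word21\<close>, the alternating words of even length; those of odd
  length are kept in the form \<open>2 # word12 k\<close> and \<open>1 # word21 k\<close>.\<close>

abbreviation word12 :: "nat \<Rightarrow> nat list" where
  "word12 k \<equiv> concat (replicate k [1,2])"

abbreviation word21 :: "nat \<Rightarrow> nat list" where
  "word21 k \<equiv> concat (replicate k [2,1])"

lemma word21_snoc: "word21 k @ [2] = 2 # word12 k"
  by (induction k) auto

lemma word12_snoc: "word12 k @ [1] = 1 # word21 k"
  by (induction k) auto

lemma word12_Suc: "word12 (Suc k) = word12 k @ [1,2]"
  by (induction k) auto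

lemma word21_Suc: "word21 (Suc k) = word21 k @ [2,1]"
  by (induction k) auto

lemma last_words: "last (2 # word12 k) = 2" "last (1 # word21 k) = 1"
  by (simp_all flip: word21_snoc word12_snoc del: last.simps)

lemma last_words_Suc: "last (word12 (Suc k)) = 2" "last (word21 (Suc k)) = 1"
  unfolding word12_Suc word21_Suc by simp_all

lemma length_word: "length (word12 k) = 2 * k" "length (word21 k) = 2 * k"
  by (induction k) auto

lemma alternating_Cons:
  "alternating (x # w) \<longleftrightarrow> x \<in> {1,2} \<and> alternating w \<and> (w \<noteq> [] \<longrightarrow> hd w \<noteq> x)"
  by (cases w) (auto simp: alternating_def)

lemma alternating_Nil: "alternating []"
  by (simp add: alternating_def)

lemma alternating_append:
  "alternating (v @ w) \<longleftrightarrow> alternating v \<and> alternating w \<and> (v \<noteq> [] \<longrightarrow> w \<noteq> [] \<longrightarrow> last v \<noteq> hd w)"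
  by (auto simp: alternating_def distinct_adj_append_iff)

lemma alternating_take: "alternating w \<Longrightarrow> alternating (take k w)"
  by (metis alternating_append append_take_drop_id)

lemma alternating_drop: "alternating w \<Longrightarrow> alternating (drop k w)"
  by (metis alternating_append append_take_drop_id)

lemma alternating_words:
  "alternating (word12 k) \<and> alternating (2 # word12 k)"
  "alternating (word21 k) \<and> alternating (1 # word21 k)"
proof -
  show "alternating (word12 k) \<and> alternating (2 # word12 k)"
    by (induction k) (auto simp: alternating_Cons alternating_Nil)
  show "alternating (word21 k) \<and> alternating (1 # word21 k)"
    by (induction k) (auto simp: alternating_Cons alternating_Nil)
qed

lemma bichar_Nil: "bichar p [] v = 1" "bichar p v [] = 1"
  by (induction v) (auto simp: bichar_def)

lemma bichar_append:
  "bichar p (u @ v) w = bichar p u w * bichar p v w"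
  "bichar p w (u @ v) = bichar p w u * bichar p w v"
  by (induction w) (auto simp: bichar_def mult_ac)

lemma bichar_Cons:
  "bichar p (x # v) w = bichar p [x] w * bichar p v w"
  "bichar p w (x # v) = bichar p w [x] * bichar p w v"
  using bichar_append[of p "[x]" v w] bichar_append(2)[of p w "[x]" v] by simp_all

lemma bichar_single: "bichar p [x] [y] = p x y"
  by (simp add: bichar_def)

lemma bichar_concat_replicate:
  "bichar p (concat (replicate k v)) w = bichar p v w ^ k"
  "bichar p w (concat (replicate k v)) = bichar p w v ^ k"
  by (induction k) (simp_all add: bichar_Nil bichar_append)

lemma skew_der_Nil: "skew_der p x u [] = u [x]"
  by (simp add: skew_der_def bichar_Nil)

lemma skew_der_Cons:
  "skew_der p x u (y # v)
    = bichar p [x] (y # v) * u (x # y # v) + skew_der p x (\<lambda>t. u (y # t)) v"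
  by (simp add: skew_der_def sum.atMost_Suc_shift del: sum.atMost_Suc)

text \<open>The two insertions of \<open>x\<close> around a letter \<open>x\<close> of \<open>v\<close> cancel because \<open>p x x = -1\<close>, and
  every inner gap of an alternating word has exactly one neighbour \<open>x\<close>.\<close>
lemma skew_der_alternating:
  assumes "alternating v" "v \<noteq> []" "x \<in> {1,2}" "p x x = -1"
  shows "skew_der p x u v = (if hd v = x then 0 else bichar p [x] v * u (x # v))
    + (if last v = x then 0 else u (v @ [x]))"
  using assms(1,2)
proof (induction v arbitrary: u)
  case (Cons y v)
  show ?case
  proof (cases "v = []")
    case True
    thus ?thesis using assms(4)
      by (auto simp: skew_der_Cons skew_der_Nil bichar_single)
  next
    case False
    hence v: "alternating v" "hd v \<noteq> y" "y \<in> {1,2}" using Cons.prems by (auto simp: alternating_Cons)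
    have hv: "hd v \<in> {1,2}" using v(1) False by (cases v) (auto simp: alternating_Cons)
    have "hd v = x \<longleftrightarrow> y \<noteq> x" using hv v(2,3) assms(3) by auto
    thus ?thesis using Cons.IH[OF v(1) False, of "\<lambda>t. u (y # t)"] False assms(4)
      by (simp add: skew_der_Cons bichar_Cons(2)[of p "[x]" y v] bichar_single)
  qed
qed simp

section \<open>Linearity and grading of the quantum symmetrizer\<close>

lemma qsym_0: "qsym p 0 = 0"
  by (simp add: qsym_eq fun_eq_iff)

lemma qsym_add: "qsym p (u + v) = qsym p u + qsym p v"
  by (simp add: qsym_eq fun_eq_iff sum.distrib distrib_left)

lemma qsym_sc: "qsym p (sc c u) = sc c (qsym p u)"
  by (simp add: qsym_eq fun_eq_iff sc_def sum_distrib_left mult.left_commute)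

text \<open>Permutations only rearrange letters, so the symmetrizer respects the bidegree. This
  serves both to exclude foreign letters and to separate the basis elements.\<close>

lemma qsym_neq_0D:
  assumes "qsym p u w \<noteq> 0"
  obtains v where "mset v = mset w" "u v \<noteq> 0"
proof -
  from assms obtain \<sigma> where s: "\<sigma> permutes {..<length w}"
    "u (map (\<lambda>a. w ! \<sigma> a) [0..<length w]) \<noteq> 0"
    unfolding qsym_eq by (auto elim!: sum.not_neutral_contains_not_neutral)
  have "map (\<lambda>a. w ! \<sigma> a) [0..<length w] = permute_list \<sigma> w" by (simp add: permute_list_def)
  thus ?thesis using that[of "permute_list \<sigma> w"] s by simp
qed

locale super_plane =
  fixes p :: "nat \<Rightarrow> nat \<Rightarrow> 'a::field_char_0"
  assumes p11: "p 1 1 = -1" and p22: "p 2 2 = -1"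
    and p12_nz: "p 1 2 \<noteq> 0" and p21_nz: "p 2 1 \<noteq> 0"
begin

text \<open>By \<open>skew_der_alternating\<close>, \<open>x\<close> is only attached to an end of
  \<open>v\<close> whose letter differs from \<open>x\<close>, and the word so obtained
  alternates.\<close>

lemma skew_der_cong_alternating:
  assumes "alternating v" "x \<in> {1,2}"
    and "\<And>w. alternating w \<Longrightarrow> length w = Suc (length v) \<Longrightarrow> u w = u' w"
  shows "skew_der p x u v = skew_der p x u' v"
proof (cases "v = []")
  case True
  thus ?thesis using assms by (simp add: skew_der_Nil alternating_Cons alternating_Nil)
next
  case False
  have "p x x = -1" using assms(2) p11 p22 by auto
  moreover have "hd v \<noteq> x \<Longrightarrow> u (x # v) = u' (x # v)" "last v \<noteq> x \<Longrightarrow> u (v @ [x]) = u' (v @ [x])"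
    using assms by (auto simp: alternating_Cons alternating_append alternating_Nil)
  ultimately show ?thesis
    by (simp add: skew_der_alternating[OF assms(1) False assms(2)])
qed

text \<open>Words with a repeated letter die here. The word \<open>w\<close> ranges over all words
  in 1 and 2; cutting off its last letter passes the agreement on alternating words from
  \<open>u\<close> and \<open>u'\<close> to their skew derivatives.\<close>

lemma qsym_cong_alternating:
  assumes "set w \<subseteq> {1,2}" "\<And>v. alternating v \<Longrightarrow> length v = length w \<Longrightarrow> u v = u' v"
  shows "qsym p u w = qsym p u' w"
  using assms
proof (induction w arbitrary: u u' rule: rev_induct)
  case Nil
  thus ?case by (simp add: qsym_Nil alternating_Nil)
next
  case (snoc x w)
  have "qsym p (skew_der p x u) w = qsym p (skew_der p x u') w"
    using snoc.prems by (intro snoc.IH skew_der_cong_alternating) auto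
  thus ?case by (simp add: qsym_snoc)
qed

text \<open>At words with other letters both sides are 0, so classes in the Nichols algebra can be
  compared on alternating words.\<close>

lemma qsym_eqI_alternating:
  assumes "tensor_supported u" "tensor_supported v" "agree_alternating u v"
  shows "qsym p u = qsym p v"
proof
  fix w
  show "qsym p u w = qsym p v w"
  proof (cases "set w \<subseteq> {1,2}")
    case True
    thus ?thesis using assms(3) by (intro qsym_cong_alternating) (auto simp: agree_alternating_def)
  next
    case False
    hence "qsym p x w = 0" if "tensor_supported x" for x
      using that by (metis qsym_neq_0D set_mset_mset tensor_supported_def)
    thus ?thesis using assms by simp
  qed
qed

section \<open>Vanishing of quantum symmetrizers\<close>

abbreviation q :: 'a where "q \<equiv> p 1 2 * p 2 1"

text \<open>The degree \<open>n\<close> part of \<open>u\<close> is zero in the Nichols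
  algebra.\<close>

definition vanishes :: "'a tens \<Rightarrow> nat \<Rightarrow> bool" where
  "vanishes u n \<longleftrightarrow> (\<forall>w. set w \<subseteq> {1,2} \<longrightarrow> length w = n \<longrightarrow> qsym p u w = 0)"

text \<open>Vanishing of the product of the factors \<open>1 - q ^ j\<close> for
  \<open>1 \<le> j \<le> k\<close>, the scalar that accumulates on the way up to degree
  \<open>2 * k + 1\<close>.\<close>

definition root_upto :: "nat \<Rightarrow> bool" where
  "root_upto k \<longleftrightarrow> (\<exists>j\<in>{1..k}. q ^ j = 1)"

lemma root_upto_Suc: "root_upto (Suc k) \<longleftrightarrow> root_upto k \<or> q ^ Suc k = 1"
  by (simp add: root_upto_def atLeastAtMostSuc_conv disj_commute del: power_Suc)

text \<open>Sorting words by their last letter turns \<open>qsym_snoc\<close> into the usual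
  criterion for Nichols algebras: an element of positive degree is zero iff both skew derivations
  kill it.\<close>

lemma vanishes_Suc: "vanishes u (Suc n) \<longleftrightarrow> vanishes (skew_der p 1 u) n \<and> vanishes (skew_der p 2 u) n"
proof -
  have "(\<forall>w. set w \<subseteq> {1,2} \<longrightarrow> length w = Suc n \<longrightarrow> qsym p u w = 0)
    \<longleftrightarrow> (\<forall>x\<in>{1,2}. \<forall>w. set w \<subseteq> {1,2} \<longrightarrow> length w = n \<longrightarrow> qsym p u (w @ [x]) = 0)"
  proof (intro iffI allI ballI impI)
    fix w :: "nat list"
    assume *: "\<forall>x\<in>{1,2}. \<forall>w. set w \<subseteq> {1,2} \<longrightarrow> length w = n \<longrightarrow> qsym p u (w @ [x]) = 0"
      "set w \<subseteq> {1,2}" "length w = Suc n"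
    then obtain v x where "w = v @ [x]" by (cases w rule: rev_cases) auto
    thus "qsym p u w = 0" using * by auto
  qed auto
  thus ?thesis by (auto simp: vanishes_def qsym_snoc)
qed

lemma bichar_1_word21: "bichar p [1] (word21 k) = (- p 1 2) ^ k"
  by (simp add: bichar_concat_replicate bichar_Cons(2)[of p "[1]"] bichar_single bichar_Nil p11)

lemma bichar_2_word12: "bichar p [2] (word12 k) = (- p 2 1) ^ k"
  by (simp add: bichar_concat_replicate bichar_Cons(2)[of p "[2]"] bichar_single bichar_Nil p22)

lemma bichar_1_odd: "bichar p [1] (2 # word12 k) = - ((- p 1 2) ^ Suc k)"
  by (simp add: bichar_concat_replicate bichar_Cons(2)[of p "[1]"] bichar_single bichar_Nil p11)

lemma bichar_2_odd: "bichar p [2] (1 # word21 k) = - ((- p 2 1) ^ Suc k)"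
  by (simp add: bichar_concat_replicate bichar_Cons(2)[of p "[2]"] bichar_single bichar_Nil p22)

lemma skew_der_values:
  "skew_der p 1 u (word12 k) = u (1 # word21 k)"
  "skew_der p 1 u (word21 k) = (- p 1 2) ^ k * u (1 # word21 k)"
  "skew_der p 2 u (word21 k) = u (2 # word12 k)"
  "skew_der p 2 u (word12 k) = (- p 2 1) ^ k * u (2 # word12 k)"
  "skew_der p 1 u (1 # word21 k) = 0"
  "skew_der p 1 u (2 # word12 k) = u (word21 (Suc k)) - (- p 1 2) ^ Suc k * u (word12 (Suc k))"
  "skew_der p 2 u (2 # word12 k) = 0"
  "skew_der p 2 u (1 # word21 k) = u (word12 (Suc k)) - (- p 2 1) ^ Suc k * u (word21 (Suc k))"
proof -
  have sd: "skew_der p x u v = (if hd v = x then 0 else bichar p [x] v * u (x # v))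
    + (if last v = x then 0 else u (v @ [x]))"
    if "alternating v" "v \<noteq> []" "x \<in> {1,2}" for x v
    using that p11 p22 by (intro skew_der_alternating) auto
  note l = last_words last_words_Suc
  have Nil: "word12 0 = []" "word21 0 = []" by simp_all
  have hd: "hd (word12 (Suc n)) = 1" "hd (word21 (Suc n)) = 2" for n by simp_all
  have ne: "word12 (Suc n) \<noteq> []" "word21 (Suc n) \<noteq> []" for n by simp_all
  \<comment> \<open>\<open>skew_der_alternating\<close> excludes the empty word, so even lengths are
    first treated at \<open>Suc n\<close>; \<open>k = 0\<close> is added through
    \<open>skew_der_Nil\<close>.\<close>
  have E: "skew_der p 1 u (word12 (Suc n)) = u (1 # word21 (Suc n))"
    "skew_der p 1 u (word21 (Suc n)) = (- p 1 2) ^ Suc n * u (1 # word21 (Suc n))"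
    "skew_der p 2 u (word21 (Suc n)) = u (2 # word12 (Suc n))"
    "skew_der p 2 u (word12 (Suc n)) = (- p 2 1) ^ Suc n * u (2 # word12 (Suc n))" for n
    using sd[of "word12 (Suc n)" 1] sd[of "word21 (Suc n)" 1]
      sd[of "word12 (Suc n)" 2] sd[of "word21 (Suc n)" 2]
      alternating_words[of "Suc n"]
    by (simp_all only: hd l ne bichar_1_word21 bichar_2_word12 word12_snoc word21_snoc) simp_all
  show "skew_der p 1 u (word12 k) = u (1 # word21 k)"
    "skew_der p 1 u (word21 k) = (- p 1 2) ^ k * u (1 # word21 k)"
    "skew_der p 2 u (word21 k) = u (2 # word12 k)"
    "skew_der p 2 u (word12 k) = (- p 2 1) ^ k * u (2 # word12 k)"
    using E[of "k - 1"] by (cases k; simp add: skew_der_Nil)+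
  have O: "1 # 2 # word12 k = word12 (Suc k)" "(2 # word12 k) @ [1] = word21 (Suc k)"
    "2 # 1 # word21 k = word21 (Suc k)" "(1 # word21 k) @ [2] = word12 (Suc k)"
    using word12_snoc[of k] word21_snoc[of k] by simp_all
  show "skew_der p 1 u (1 # word21 k) = 0"
    "skew_der p 1 u (2 # word12 k) = u (word21 (Suc k)) - (- p 1 2) ^ Suc k * u (word12 (Suc k))"
    "skew_der p 2 u (2 # word12 k) = 0"
    "skew_der p 2 u (1 # word21 k) = u (word12 (Suc k)) - (- p 2 1) ^ Suc k * u (word21 (Suc k))"
    using sd[of "1 # word21 k" 1] sd[of "2 # word12 k" 1]
      sd[of "1 # word21 k" 2] sd[of "2 # word12 k" 2] alternating_words[of k]
    by (simp_all only: l O bichar_1_odd bichar_2_odd list.sel) simp_all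
qed

lemma vanishes_0: "vanishes u 0 \<longleftrightarrow> u [] = 0"
  by (simp add: vanishes_def qsym_Nil)

text \<open>Each skew derivation lands in degree \<open>2 * k + 1\<close> and contributes one linear
  condition on the values at the two even alternating words. The odd case is a hypothesis so that
  the step is available inside the induction for \<open>vanishes_odd\<close>.\<close>

lemma vanishes_even_step:
  assumes "\<And>u. vanishes u (Suc (2 * k)) \<longleftrightarrow> root_upto k \<or> u (1 # word21 k) = 0 \<and> u (2 # word12 k) = 0"
  shows "vanishes u (2 * Suc k) \<longleftrightarrow> root_upto k \<or>
     u (word12 (Suc k)) = (- p 2 1) ^ Suc k * u (word21 (Suc k)) \<and>
     u (word21 (Suc k)) = (- p 1 2) ^ Suc k * u (word12 (Suc k))"
proof -
  have "vanishes u (2 * Suc k) \<longleftrightarrow> vanishes u (Suc (Suc (2 * k)))" by simp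
  thus ?thesis
    by (auto simp only: vanishes_Suc[of u "Suc (2 * k)"] assms skew_der_values right_minus_eq)
qed

text \<open>A skew derivation spreads the value \<open>c\<close> at one odd word over both even
  words of the degree below; the even conditions on it then reduce to
  \<open>c = q ^ Suc k * c\<close>. Hence one new root of unity condition in each odd
  degree.\<close>

lemma vanishes_odd:
  "vanishes u (Suc (2 * k)) \<longleftrightarrow> root_upto k \<or> u (1 # word21 k) = 0 \<and> u (2 # word12 k) = 0"
proof (induction k arbitrary: u)
  case 0
  thus ?case by (auto simp: vanishes_Suc vanishes_0 skew_der_Nil root_upto_def One_nat_def)
next
  case (Suc k)
  have eq: "(c = a ^ Suc k * (b ^ Suc k * c)) \<longleftrightarrow> (a * b) ^ Suc k = 1 \<or> c = 0" for a b c :: 'a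
    by (auto simp: power_mult_distrib mult_ac)
  have "(- p 2 1) * (- p 1 2) = q" "(- p 1 2) * (- p 2 1) = q" by simp_all
  hence "vanishes u (Suc (2 * Suc k)) \<longleftrightarrow> root_upto k \<or> q ^ Suc k = 1
      \<or> u (1 # word21 (Suc k)) = 0 \<and> u (2 # word12 (Suc k)) = 0"
    unfolding vanishes_Suc[of u "2 * Suc k"] vanishes_even_step[OF Suc.IH] skew_der_values
    by (auto simp only: eq)
  thus ?case by (simp only: root_upto_Suc disj_assoc)
qed

lemmas vanishes_even = vanishes_even_step[OF vanishes_odd]

section \<open>Zero criteria for \<open>elA\<close>, \<open>elB\<close> and
  \<open>elC\<close>\<close>

lemma word_not_alternating: "\<not> alternating v \<Longrightarrow> alternating w \<Longrightarrow> word v w = 0"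
  by (auto simp: word_def)

lemma elB_eq: "elB k = word (2 # word12 k)"
  by (simp add: elB_def)

lemma elC_eq: "elC k = word (1 # word21 k)"
  by (simp only: elC_def word12_snoc)

lemma elA_eq:
  "elA p k = sc (p 1 2 ^ Suc k) (word (word12 (Suc k))) - sc (p 2 1 ^ Suc k) (word (word21 (Suc k)))"
  by (simp only: elA_def Suc_eq_plus1)

lemma length_elA: "elA p k w \<noteq> 0 \<Longrightarrow> length w = 2 * Suc k"
  using length_word[of "Suc k"]
  by (auto simp: elA_eq sc_def word_def simp del: replicate_Suc split: if_splits)

lemma count_mset_words:
  "count (mset (word12 k)) 1 = k" "count (mset (word12 k)) 2 = k"
  "count (mset (word21 k)) 1 = k" "count (mset (word21 k)) 2 = k"
  by (induction k) auto

text \<open>The symmetrizer of a homogeneous tensor is supported on rearrangements of its words, all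
  of length \<open>n\<close>, so this one degree decides.\<close>

lemma qsym_eq_0_iff:
  assumes "tensor_supported u" "\<And>w. u w \<noteq> 0 \<Longrightarrow> length w = n"
  shows "qsym p u = 0 \<longleftrightarrow> vanishes u n"
proof
  assume v: "vanishes u n"
  have "qsym p u w = 0" for w
  proof (rule ccontr)
    assume nz: "qsym p u w \<noteq> 0"
    then obtain v where "mset v = mset w" "u v \<noteq> 0" by (rule qsym_neq_0D)
    hence "set w \<subseteq> {1,2}" "length w = n"
      using assms by (metis tensor_supported_def set_mset_mset, metis size_mset)
    thus False using v nz by (simp add: vanishes_def)
  qed
  thus "qsym p u = 0" by (simp add: fun_eq_iff)
qed (simp add: vanishes_def)

lemma tensor_supported_word: "alternating v \<Longrightarrow> tensor_supported (word v)"
  by (auto simp: tensor_supported_def word_def alternating_def)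

lemma tensor_supported_add: "tensor_supported u \<Longrightarrow> tensor_supported v \<Longrightarrow> tensor_supported (u + v)"
  for u v :: "'a tens"
  by (force simp: tensor_supported_def)

lemma tensor_supported_diff: "tensor_supported u \<Longrightarrow> tensor_supported v \<Longrightarrow> tensor_supported (u - v)"
  for u v :: "'a tens"
  by (force simp: tensor_supported_def)

lemma tensor_supported_sc: "tensor_supported u \<Longrightarrow> tensor_supported (sc c u)"
  by (simp add: tensor_supported_def sc_def)

lemma tensor_supported_el:
  "tensor_supported (elA p k)" "tensor_supported (elB k)" "tensor_supported (elC k)"
  unfolding elA_eq elB_eq elC_eq
  by (intro tensor_supported_diff tensor_supported_sc tensor_supported_word
      alternating_words[THEN conjunct1] alternating_words[THEN conjunct2])+

lemma word12_neq_word21: "word12 (Suc k) \<noteq> word21 (Suc n)"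
  by simp

lemma elA_values:
  "elA p k (word12 (Suc k)) = p 1 2 ^ Suc k" "elA p k (word21 (Suc k)) = - (p 2 1 ^ Suc k)"
  using word12_neq_word21[of k k] by (auto simp: elA_eq sc_def word_def simp del: replicate_Suc)

lemma qsym_elB_eq_0_iff: "qsym p (elB k) = 0 \<longleftrightarrow> root_upto k"
proof -
  have "qsym p (elB k) = 0 \<longleftrightarrow> vanishes (elB k) (Suc (2 * k))"
    using tensor_supported_el(2)
    by (rule qsym_eq_0_iff) (auto simp: elB_eq word_def length_word split: if_splits)
  thus ?thesis by (simp add: vanishes_odd elB_eq word_def)
qed

lemma qsym_elC_eq_0_iff: "qsym p (elC k) = 0 \<longleftrightarrow> root_upto k"
proof -
  have "qsym p (elC k) = 0 \<longleftrightarrow> vanishes (elC k) (Suc (2 * k))"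
    using tensor_supported_el(3)
    by (rule qsym_eq_0_iff) (auto simp: elC_eq word_def length_word split: if_splits)
  thus ?thesis by (simp add: vanishes_odd elC_eq word_def)
qed

text \<open>Translates the range \<open>k < m\<close> into nonvanishing in degree
  \<open>2 * k + 1\<close>, for finite and infinite order alike.\<close>

lemma less_mord_iff: "enat k < mord q \<longleftrightarrow> \<not> root_upto k"
proof (cases "\<exists>n>0. q ^ n = 1")
  case True
  define m where "m = (LEAST n. n > 0 \<and> q ^ n = 1)"
  have m: "m > 0" "q ^ m = 1" using LeastI_ex[OF True] by (auto simp: m_def)
  have least: "m \<le> j" if "j > 0" "q ^ j = 1" for j
    unfolding m_def using that by (intro Least_le) simp
  have "mord q = enat m" unfolding mord_def m_def using True by (simp only: if_True)
  moreover have "k < m \<longleftrightarrow> \<not> root_upto k"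
  proof
    assume "k < m"
    show "\<not> root_upto k"
    proof
      assume "root_upto k"
      then obtain j where "1 \<le> j" "j \<le> k" "q ^ j = 1" by (auto simp only: root_upto_def atLeastAtMost_iff)
      thus False using least[of j] \<open>k < m\<close> by simp
    qed
  next
    assume nr: "\<not> root_upto k"
    show "k < m"
    proof (rule ccontr)
      assume "\<not> k < m"
      hence "m \<in> {1..k}" using m(1) by simp
      thus False using nr m(2) unfolding root_upto_def by blast
    qed
  qed
  ultimately show ?thesis by simp
next
  case False
  have "\<not> root_upto k"
  proof
    assume "root_upto k"
    then obtain j where "1 \<le> j" "q ^ j = 1" by (auto simp only: root_upto_def atLeastAtMost_iff)
    moreover have "0 < j" using \<open>1 \<le> j\<close> by simp
    ultimately show False using False by blast
  qed
  moreover have "mord q = \<infinity>" unfolding mord_def using False by (simp only: if_False)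
  ultimately show ?thesis by simp
qed

lemma mord_eq_Suc_iff: "mord q = enat (Suc k) \<longleftrightarrow> \<not> root_upto k \<and> q ^ Suc k = 1"
proof -
  have "mord q = enat (Suc k) \<longleftrightarrow> enat k < mord q \<and> \<not> enat (Suc k) < mord q"
    by (cases "mord q") auto
  thus ?thesis by (auto simp only: less_mord_iff root_upto_Suc)
qed

lemma mord_eq_enatD: "mord q = enat m \<Longrightarrow> \<exists>k. m = Suc k"
  using less_mord_iff[of 0] by (cases m) (auto simp: root_upto_def One_nat_def zero_enat_def)

text \<open>The left side is what \<open>vanishes_even\<close> demands of the coefficients of
  \<open>elA\<close>. With \<open>a\<close>, \<open>b\<close>, \<open>s\<close> the powers of
  \<open>p 1 2\<close>, \<open>p 2 1\<close> and \<open>-1\<close>, both sides say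
  \<open>a = - s * b ^ 2\<close> and \<open>b = - s * a ^ 2\<close>, since \<open>s\<close> is a
  sign.\<close>

lemma exceptional_iff:
  "p 1 2 ^ n = (- p 2 1) ^ n * - (p 2 1 ^ n) \<and> - (p 2 1 ^ n) = (- p 1 2) ^ n * p 1 2 ^ n
    \<longleftrightarrow> (- (inverse (p 1 2) ^ 2 * p 2 1)) ^ n = -1 \<and> (- (p 1 2 * inverse (p 2 1) ^ 2)) ^ n = -1"
proof -
  define a b s where "a = p 1 2 ^ n" and "b = p 2 1 ^ n" and "s = (-1 :: 'a) ^ n"
  have nz: "a \<noteq> 0" "b \<noteq> 0" using p12_nz p21_nz by (auto simp: a_def b_def)
  have s: "s = 1 \<or> s = -1" unfolding s_def by (cases "even n") auto
  have m: "(- x) ^ n = s * x ^ n" for x :: 'a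
    unfolding s_def by (metis mult_minus1 power_mult_distrib)
  have pow: "(x * inverse y ^ 2) ^ n = x ^ n / (y ^ n)\<^sup>2" for x y :: 'a
    by (simp only: divide_inverse power_mult_distrib power_inverse power_mult[symmetric] mult.commute[of n 2])
  have "(- (inverse (p 1 2) ^ 2 * p 2 1)) ^ n = s * (b / a\<^sup>2)"
    unfolding m mult.commute[of "inverse (p 1 2) ^ 2"] pow a_def b_def ..
  moreover have "(- (p 1 2 * inverse (p 2 1) ^ 2)) ^ n = s * (a / b\<^sup>2)"
    unfolding m pow a_def b_def ..
  moreover have "a = s * b * - b \<and> - b = s * a * a \<longleftrightarrow> s * (b / a\<^sup>2) = -1 \<and> s * (a / b\<^sup>2) = -1"
  proof -
    have b: "b / a\<^sup>2 = c \<longleftrightarrow> b = c * a\<^sup>2" and a: "a / b\<^sup>2 = c \<longleftrightarrow> a = c * b\<^sup>2" for c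
      using nz by (simp_all add: divide_eq_eq)
    have sc: "s * x = -1 \<longleftrightarrow> x = - s" for x using s by (auto simp: minus_equation_iff[of x])
    have minus: "b = - (s * (a * a)) \<longleftrightarrow> - b = s * (a * a)" by (metis minus_minus)
    show ?thesis unfolding sc a b unfolding power2_eq_square
      by (simp only: mult.assoc mult_minus_left mult_minus_right minus conj_commute)
  qed
  ultimately show ?thesis
    by (simp only: m a_def[symmetric] b_def[symmetric] mult_minus_right mult.assoc)
qed

lemma qsym_elA_eq_0_iff:
  "qsym p (elA p k) = 0 \<longleftrightarrow> root_upto k \<or> exceptional p \<and> mord q = enat (Suc k)"
proof -
  have van: "qsym p (elA p k) = 0 \<longleftrightarrow> vanishes (elA p k) (2 * Suc k)"
    by (rule qsym_eq_0_iff[OF tensor_supported_el(1) length_elA])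
  show ?thesis
  proof (cases "root_upto k")
    case False
    let ?cond = "p 1 2 ^ Suc k = (- p 2 1) ^ Suc k * - (p 2 1 ^ Suc k)
      \<and> - (p 2 1 ^ Suc k) = (- p 1 2) ^ Suc k * p 1 2 ^ Suc k"
    have "qsym p (elA p k) = 0 \<longleftrightarrow> vanishes (elA p k) (2 * Suc k)" by (rule van)
    also have "\<dots> \<longleftrightarrow> ?cond"
      by (simp only: vanishes_even elA_values False simp_thms)
    \<comment> \<open>The two conditions already force \<open>q ^ Suc k = 1\<close>: substituting
      one into the other gives \<open>a * (a * b) = a\<close> with \<open>a\<close> nonzero. As
      \<open>root_upto k\<close> fails, \<open>Suc k\<close> is then the exact order of
      \<open>q\<close>.\<close>
    also have "\<dots> \<longleftrightarrow> q ^ Suc k = 1 \<and> ?cond"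
    proof -
      have "q ^ Suc k = 1" if ?cond
      proof -
        define a b s where "a = p 1 2 ^ Suc k" and "b = p 2 1 ^ Suc k" and "s = (-1 :: 'a) ^ Suc k"
        have nz: "a \<noteq> 0" using p12_nz by (auto simp: a_def)
        have s: "s * s = 1" unfolding s_def by (simp flip: power_mult_distrib)
        have m: "(- x) ^ Suc k = s * x ^ Suc k" for x :: 'a
          unfolding s_def by (metis mult_minus1 power_mult_distrib)
        have ab: "a = s * (b * - b) \<and> - b = s * (a * a)"
          using that unfolding m a_def b_def mult.assoc .
        have "a * (a * b) = a"
        proof -
          have "a * (a * b) = s * (s * (a * a)) * b"
            using s by (simp add: mult.assoc[symmetric])
          also have "\<dots> = s * (b * - b)"
            unfolding ab[THEN conjunct2, symmetric] by simp
          also have "\<dots> = a" by (rule ab[THEN conjunct1, symmetric])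
          finally show ?thesis .
        qed
        hence "a * b = 1" using nz by simp
        thus ?thesis by (simp only: a_def b_def power_mult_distrib)
      qed
      thus ?thesis by blast
    qed
    also have "\<dots> \<longleftrightarrow> exceptional p \<and> mord q = enat (Suc k)"
    proof -
      have "exceptional p \<and> mord q = enat (Suc k) \<longleftrightarrow> mord q = enat (Suc k) \<and>
          (- (inverse (p 1 2) ^ 2 * p 2 1)) ^ Suc k = -1 \<and> (- (p 1 2 * inverse (p 2 1) ^ 2)) ^ Suc k = -1"
        unfolding exceptional_def by (metis enat.inject)
      thus ?thesis using exceptional_iff[of "Suc k"] mord_eq_Suc_iff[of k] False by blast
    qed
    finally show ?thesis using False by blast
  next
    case True
    thus ?thesis by (simp only: van vanishes_even simp_thms)
  qed
qed

section \<open>The generated Lie algebra\<close>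

text \<open>Carries the linearity rules, proved in the left argument, to the right one in
  \<open>rbr_right\<close>.\<close>

lemma rbr_antisym: "rbr p v u = sc (-1) (rbr p u v)"
  by (simp add: rbr_def sc_def fun_eq_iff flip: sum_negf, intro allI sum.cong)
    (auto simp: algebra_simps)

lemma rbr_add: "rbr p (u + u') v = rbr p u v + rbr p u' v"
  by (simp add: rbr_def fun_eq_iff algebra_simps flip: sum.distrib)

lemma rbr_sc: "rbr p (sc c u) v = sc c (rbr p u v)"
  by (simp add: rbr_def sc_def fun_eq_iff algebra_simps sum_distrib_left)

lemma rbr_diff: "rbr p (u - u') v = rbr p u v - rbr p u' v"
  by (simp add: rbr_def fun_eq_iff algebra_simps flip: sum_subtractf)

lemma rbr_right:
  "rbr p v (sc c u) = sc c (rbr p v u)" "rbr p v (u - u') = rbr p v u - rbr p v u'"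
  unfolding rbr_antisym[of v] rbr_sc rbr_diff by (simp_all add: sc_def fun_eq_iff)

text \<open>A word splits into \<open>a\<close> followed by \<open>b\<close> at one place only,
  \<open>k = length a\<close>.\<close>

lemma sum_splittings:
  "(\<Sum>k\<le>length w. f (take k w) (drop k w) * (word a (take k w) * word b (drop k w)))
    = f a b * word (a @ b) w" for f :: "nat list \<Rightarrow> nat list \<Rightarrow> 'a"
proof -
  have "(\<Sum>k\<le>length w. f (take k w) (drop k w) * (word a (take k w) * word b (drop k w)))
    = (\<Sum>k\<le>length w. if k = length a then f a b * word (a @ b) w else 0)"
  proof (rule sum.cong)
    fix k assume k: "k \<in> {..length w}"
    have "take k w = a \<and> drop k w = b \<longleftrightarrow> w = a @ b \<and> k = length a"
      using k by (auto simp: append_eq_conv_conj)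
    hence prod: "(word a (take k w) :: 'a) * word b (drop k w) = (if w = a @ b \<and> k = length a then 1 else 0)"
      unfolding word_def by auto
    thus "f (take k w) (drop k w) * (word a (take k w) * word b (drop k w))
      = (if k = length a then f a b * word (a @ b) w else 0)"
      unfolding prod by (auto simp: word_def)
  qed simp
  thus ?thesis by (auto simp: word_def)
qed

lemma rbr_word:
  "rbr p (word a) (word b)
    = sc (bichar p a b) (word (a @ b)) - sc (bichar p b a) (word (b @ a))"
proof
  fix w
  have "rbr p (word a) (word b) w
    = (\<Sum>k\<le>length w. bichar p (take k w) (drop k w) * (word a (take k w) * word b (drop k w)))
     - (\<Sum>k\<le>length w. bichar p (take k w) (drop k w) * (word b (take k w) * word a (drop k w)))"
    by (simp add: rbr_def right_diff_distrib sum_subtractf)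
  thus "rbr p (word a) (word b) w
      = (sc (bichar p a b) (word (a @ b)) - sc (bichar p b a) (word (b @ a))) w"
    by (simp only: sum_splittings) (simp add: sc_def)
qed

text \<open>Prefixes and suffixes of alternating words alternate; equivalently, the tensors that
  vanish on alternating words form an ideal for the bracket.\<close>

lemma agree_alternating_rbr:
  assumes "agree_alternating u u'" "agree_alternating v v'"
  shows "agree_alternating (rbr p u v) (rbr p u' v')"
  using assms by (auto simp: agree_alternating_def rbr_def alternating_take alternating_drop)

lemma agree_alternating_refl: "agree_alternating u u"
  by (simp add: agree_alternating_def)

lemma agree_alternating_trans:
  "agree_alternating u v \<Longrightarrow> agree_alternating v w \<Longrightarrow> agree_alternating u w"
  by (simp add: agree_alternating_def)

section \<open>Products of alternating words and the resulting brackets\<close>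

lemma word_append:
  "word12 j @ word12 k = word12 (j + k)" "word21 j @ word21 k = word21 (j + k)"
  "word12 j @ 1 # word21 k = 1 # word21 (j + k)" "(1 # word21 k) @ word21 j = 1 # word21 (j + k)"
  "word21 j @ 2 # word12 k = 2 # word12 (j + k)" "(2 # word12 k) @ word12 j = 2 # word12 (j + k)"
  "(1 # word21 j) @ 2 # word12 k = word12 (Suc (j + k))"
  "(2 # word12 j) @ 1 # word21 k = word21 (Suc (j + k))"
proof -
  show 1: "word12 j @ word12 k = word12 (j + k)" and 2: "word21 j @ word21 k = word21 (j + k)" for j k
    by (simp_all add: replicate_add)
  show "word12 j @ 1 # word21 k = 1 # word21 (j + k)"
    by (simp only: word12_snoc[symmetric] append_assoc[symmetric] 1)
  show "word21 j @ 2 # word12 k = 2 # word12 (j + k)"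
    by (simp only: word21_snoc[symmetric] append_assoc[symmetric] 2)
  show "(1 # word21 k) @ word21 j = 1 # word21 (j + k)" using 2[of k j] by (simp add: add.commute)
  show "(2 # word12 k) @ word12 j = 2 # word12 (j + k)" using 1[of k j] by (simp add: add.commute)
  show "(1 # word21 j) @ 2 # word12 k = word12 (Suc (j + k))"
    using 1[of j "Suc k"] by (simp flip: word12_snoc)
  show "(2 # word12 j) @ 1 # word21 k = word21 (Suc (j + k))"
    using 2[of j "Suc k"] by (simp flip: word21_snoc)
qed

text \<open>Equal letters meet at the seam; these are the products dropped from the
  brackets.\<close>

lemma junk_words:
  "\<not> alternating (word12 (Suc j) @ word21 (Suc k))" "\<not> alternating (word21 (Suc j) @ word12 (Suc k))"
  "\<not> alternating (word21 (Suc j) @ 1 # word21 k)" "\<not> alternating ((1 # word21 k) @ word12 (Suc j))"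
  "\<not> alternating (word12 (Suc j) @ 2 # word12 k)" "\<not> alternating ((2 # word12 k) @ word21 (Suc j))"
  "\<not> alternating ((1 # word21 j) @ 1 # word21 k)" "\<not> alternating ((2 # word12 j) @ 2 # word12 k)"
proof -
  have hd: "hd (word12 (Suc n)) = 1" "hd (word21 (Suc n)) = 2" for n by simp_all
  have ne: "word12 (Suc n) \<noteq> []" "word21 (Suc n) \<noteq> []" for n by simp_all
  note junk = alternating_append last_words last_words_Suc hd ne list.sel list.distinct
  show "\<not> alternating (word12 (Suc j) @ word21 (Suc k))" "\<not> alternating (word21 (Suc j) @ word12 (Suc k))"
    "\<not> alternating (word21 (Suc j) @ 1 # word21 k)" "\<not> alternating ((1 # word21 k) @ word12 (Suc j))"
    "\<not> alternating (word12 (Suc j) @ 2 # word12 k)" "\<not> alternating ((2 # word12 k) @ word21 (Suc j))"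
    "\<not> alternating ((1 # word21 j) @ 1 # word21 k)" "\<not> alternating ((2 # word12 j) @ 2 # word12 k)"
    unfolding junk by simp_all
qed

lemma bichar_pair:
  "bichar p [x, y] w = bichar p [x] w * bichar p [y] w"
  "bichar p w [x, y] = bichar p w [x] * bichar p w [y]"
  by (rule bichar_Cons)+

text \<open>The signs \<open>p 1 1\<close> and \<open>p 2 2\<close> cancel, leaving \<open>q\<close>
  whatever the order of the letters.\<close>

lemma bichar_pair_pair:
  "bichar p [1, 2] [1, 2] = q" "bichar p [2, 1] [2, 1] = q"
  "bichar p [1, 2] [2, 1] = q" "bichar p [2, 1] [1, 2] = q"
  by (simp_all add: bichar_pair bichar_single p11 p22 mult.commute)

lemma bichar_pair_values:
  "bichar p [1, 2] (1 # word21 k) = - p 2 1 * q ^ k" "bichar p (1 # word21 k) [2, 1] = - p 1 2 * q ^ k"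
  "bichar p [2, 1] (2 # word12 k) = - p 1 2 * q ^ k" "bichar p (2 # word12 k) [1, 2] = - p 2 1 * q ^ k"
proof -
  note c = bichar_concat_replicate bichar_pair_pair
  show "bichar p [1, 2] (1 # word21 k) = - p 2 1 * q ^ k"
    unfolding bichar_Cons(2)[of p _ 1 "word21 k"] c by (simp add: bichar_pair bichar_single p11)
  show "bichar p (1 # word21 k) [2, 1] = - p 1 2 * q ^ k"
    unfolding bichar_Cons(1)[of p 1 "word21 k"] c by (simp add: bichar_pair bichar_single p11)
  show "bichar p [2, 1] (2 # word12 k) = - p 1 2 * q ^ k"
    unfolding bichar_Cons(2)[of p _ 2 "word12 k"] c by (simp add: bichar_pair bichar_single p22)
  show "bichar p (2 # word12 k) [1, 2] = - p 2 1 * q ^ k"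
    unfolding bichar_Cons(1)[of p 2 "word12 k"] c by (simp add: bichar_pair bichar_single p22)
qed

lemma bichar_word_values:
  "bichar p (word12 j) (word12 k) = q ^ (j * k)"
  "bichar p (word21 j) (word21 k) = q ^ (j * k)"
  "bichar p (word12 j) (1 # word21 k) = (- p 2 1) ^ j * q ^ (j * k)"
  "bichar p (1 # word21 k) (word21 j) = (- p 1 2) ^ j * q ^ (j * k)"
  "bichar p (word21 j) (2 # word12 k) = (- p 1 2) ^ j * q ^ (j * k)"
  "bichar p (2 # word12 k) (word12 j) = (- p 2 1) ^ j * q ^ (j * k)"
  "bichar p (1 # word21 j) (2 # word12 k) = q ^ (j * k) * (-1) ^ (j + k) * p 1 2 ^ Suc (j + k)"
  "bichar p (2 # word12 k) (1 # word21 j) = q ^ (j * k) * (-1) ^ (j + k) * p 2 1 ^ Suc (j + k)"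
proof -
  have pow: "(- x * q ^ k) ^ j = (- x) ^ j * q ^ (j * k)" for x j k
    unfolding power_mult_distrib[of "- x"] power_mult[symmetric] mult.commute[of j] by (rule refl)
  show "bichar p (word12 j) (word12 k) = q ^ (j * k)" "bichar p (word21 j) (word21 k) = q ^ (j * k)" for j k
    unfolding bichar_concat_replicate bichar_pair_pair power_mult[symmetric]
    by (simp_all only: mult.commute)
  show w12: "bichar p (word12 j) (1 # word21 k) = (- p 2 1) ^ j * q ^ (j * k)"
    and "bichar p (1 # word21 k) (word21 j) = (- p 1 2) ^ j * q ^ (j * k)"
    and w21: "bichar p (word21 j) (2 # word12 k) = (- p 1 2) ^ j * q ^ (j * k)"
    and "bichar p (2 # word12 k) (word12 j) = (- p 2 1) ^ j * q ^ (j * k)" for j k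
    by (simp_all only: bichar_concat_replicate bichar_pair_values pow)
  have neg: "(- x) ^ n = (-1) ^ n * x ^ n" for x :: 'a and n
    by (metis mult_minus1 power_mult_distrib)
  have "bichar p (1 # word21 j) (2 # word12 k) = - ((- p 1 2) ^ Suc k) * ((- p 1 2) ^ j * q ^ (j * k))"
    by (simp only: bichar_Cons(1)[of p 1 "word21 j"] bichar_1_odd w21)
  also have "\<dots> = q ^ (j * k) * (-1) ^ (j + k) * p 1 2 ^ Suc (j + k)"
    by (simp add: neg[of "p 1 2"] power_add)
  finally show "bichar p (1 # word21 j) (2 # word12 k) = q ^ (j * k) * (-1) ^ (j + k) * p 1 2 ^ Suc (j + k)" .
  have "bichar p (2 # word12 k) (1 # word21 j) = - ((- p 2 1) ^ Suc j) * ((- p 2 1) ^ k * q ^ (k * j))"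
    by (simp only: bichar_Cons(1)[of p 2 "word12 k"] bichar_2_odd w12)
  also have "\<dots> = q ^ (j * k) * (-1) ^ (j + k) * p 2 1 ^ Suc (j + k)"
    by (simp add: neg[of "p 2 1"] power_add mult.commute[of k j])
  finally show "bichar p (2 # word12 k) (1 # word21 j) = q ^ (j * k) * (-1) ^ (j + k) * p 2 1 ^ Suc (j + k)" .
qed

text \<open>Both products alternate, so the equality is exact. The two bicharacter values share the
  scalar on the right, and what remains are the coefficients of \<open>elA\<close>, which explains
  its form.\<close>

lemma rbr_CB: "rbr p (elC j) (elB k) = sc (q ^ (j * k) * (-1) ^ (j + k)) (elA p (j + k))"
  unfolding elA_eq elB_eq elC_eq rbr_word word_append bichar_word_values
  by (simp add: sc_def fun_eq_iff algebra_simps add.commute[of k j] del: replicate_Suc)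

lemma neg_power: "p 1 2 ^ n * (- p 2 1) ^ n = (- q) ^ n" "p 2 1 ^ n * (- p 1 2) ^ n = (- q) ^ n"
  by (simp_all add: mult.commute flip: power_mult_distrib)

text \<open>Only \<open>word12\<close> times \<open>elC k\<close> and \<open>elC k\<close> times
  \<open>word21\<close> survive, and they are the same word. The minus signs of \<open>elA\<close>
  and of the bracket combine, so two equal scalars add up to the factor 2.\<close>

lemma rbr_AC:
  "agree_alternating (rbr p (elA p j) (elC k)) (sc (2 * (- q) ^ Suc j * q ^ (Suc j * k)) (elC (Suc j + k)))"
proof -
  let ?n = "Suc j"
  have "p 1 2 ^ ?n * ((- p 2 1) ^ ?n * q ^ (?n * k)) + p 2 1 ^ ?n * ((- p 1 2) ^ ?n * q ^ (?n * k))
      = 2 * (- q) ^ ?n * q ^ (?n * k)"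
    by (simp only: mult.assoc[symmetric] neg_power mult_2 distrib_right)
  thus ?thesis
    unfolding elA_eq elC_eq rbr_diff rbr_sc rbr_word word_append bichar_word_values agree_alternating_def
    by (auto simp only: sc_def fun_diff_def word_not_alternating junk_words not_False_eq_True
        mult_zero_right diff_0 diff_zero mult_minus_right diff_minus_eq_add
        mult.assoc[symmetric] distrib_right[symmetric])
qed

text \<open>Mirror image of \<open>rbr_AC\<close>: \<open>elB k\<close> times \<open>word12\<close>
  and \<open>word21\<close> times \<open>elB k\<close> survive, each with a minus sign.\<close>

lemma rbr_AB:
  "agree_alternating (rbr p (elA p j) (elB k)) (sc (- (2 * (- q) ^ Suc j * q ^ (Suc j * k))) (elB (Suc j + k)))"
proof -
  let ?n = "Suc j"
  have key: "- (2 * (- q) ^ ?n * q ^ (?n * k)) * x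
      = - (p 1 2 ^ ?n * ((- p 2 1) ^ ?n * q ^ (?n * k) * x)) - p 2 1 ^ ?n * ((- p 1 2) ^ ?n * q ^ (?n * k) * x)" for x
    by (simp only: mult.assoc[symmetric] neg_power mult_2 distrib_right mult_minus_left
        minus_add_distrib diff_conv_add_uminus)
  show ?thesis
    unfolding elA_eq elB_eq rbr_diff rbr_sc rbr_word word_append bichar_word_values agree_alternating_def
    by (auto simp only: sc_def fun_diff_def word_not_alternating junk_words not_False_eq_True
        mult_zero_right diff_0 diff_zero mult_minus_right key)
qed

text \<open>Powers of \<open>12\<close> commute and have a symmetric bicharacter, likewise powers of
  \<open>21\<close>; in every other product equal letters meet.\<close>

lemma rbr_same:
  "agree_alternating (rbr p (elA p j) (elA p k)) 0"
  "agree_alternating (rbr p (elB j) (elB k)) 0"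
  "agree_alternating (rbr p (elC j) (elC k)) 0"
  unfolding elA_eq elB_eq elC_eq rbr_diff rbr_right rbr_sc rbr_word word_append
    bichar_word_values agree_alternating_def
  by (auto simp only: sc_def fun_diff_def zero_fun_def word_not_alternating junk_words not_False_eq_True
        mult_zero_right diff_0 diff_zero minus_zero mult_minus_right add.commute[of k j] mult.commute[of k j]
        add.commute[of "Suc k" "Suc j"] mult.commute[of "Suc k" "Suc j"] diff_self)

end

section \<open>Upper bound: the span of the elements modulo repeated letters\<close>

interpretation tens: vector_space "sc :: 'a::field \<Rightarrow> 'a tens \<Rightarrow> 'a tens"
  by unfold_locales (simp_all add: sc_def fun_eq_iff algebra_simps)

context super_plane
begin

definition generators :: "'a tens set" where
  "generators = range (elA p) \<union> range elB \<union> range elC"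

text \<open>The bracket relations hold only up to words with a repeated letter, so the span is
  enlarged by the tensors that vanish on alternating words.\<close>

definition lie_closure :: "'a tens set" where
  "lie_closure = {u. \<exists>v\<in>tens.span generators. agree_alternating u v}"

lemma subspace_lie_closure: "tens.subspace lie_closure"
proof (rule tens.subspaceI)
  show "0 \<in> lie_closure"
    using tens.span_zero[of generators] agree_alternating_refl unfolding lie_closure_def by blast
  show "u + v \<in> lie_closure" if uv: "u \<in> lie_closure" "v \<in> lie_closure" for u v
  proof -
    from uv obtain u' v' where "u' \<in> tens.span generators" "v' \<in> tens.span generators"
      "agree_alternating u u'" "agree_alternating v v'" by (auto simp: lie_closure_def)
    thus ?thesis unfolding lie_closure_def
      by (intro CollectI bexI[of _ "u' + v'"] tens.span_add) (auto simp: agree_alternating_def)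
  qed
  show "sc c u \<in> lie_closure" if u: "u \<in> lie_closure" for c u
  proof -
    from u obtain u' where "u' \<in> tens.span generators" "agree_alternating u u'"
      by (auto simp: lie_closure_def)
    thus ?thesis unfolding lie_closure_def
      by (intro CollectI bexI[of _ "sc c u'"] tens.span_scale) (auto simp: agree_alternating_def sc_def)
  qed
qed

lemma lie_closureI:
  "agree_alternating u (sc c g) \<Longrightarrow> g \<in> generators \<Longrightarrow> u \<in> lie_closure"
  unfolding lie_closure_def using tens.span_scale[OF tens.span_base] by blast

lemma lie_closure_0I: "agree_alternating u 0 \<Longrightarrow> u \<in> lie_closure"
  unfolding lie_closure_def using tens.span_zero by blast

lemma rbr_generators:
  assumes "u \<in> generators" "v \<in> generators"
  shows "rbr p u v \<in> lie_closure"
proof -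
  have g: "elA p j \<in> generators" "elB j \<in> generators" "elC j \<in> generators" for j
    by (auto simp: generators_def)
  have swap: "rbr p y x \<in> lie_closure" if "rbr p x y \<in> lie_closure" for x y
    unfolding rbr_antisym[of y x] by (rule tens.subspace_scale[OF subspace_lie_closure that])
  have AB: "rbr p (elA p j) (elB k) \<in> lie_closure" for j k by (rule lie_closureI[OF rbr_AB g(2)])
  have AC: "rbr p (elA p j) (elC k) \<in> lie_closure" for j k by (rule lie_closureI[OF rbr_AC g(3)])
  have CB: "rbr p (elC j) (elB k) \<in> lie_closure" for j k
    unfolding rbr_CB by (rule lie_closureI[OF agree_alternating_refl g(1)])
  show ?thesis using assms unfolding generators_def
    by (auto intro: swap AB AC CB swap[OF AB] swap[OF AC] swap[OF CB] lie_closure_0I rbr_same)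
qed

lemma rbr_span:
  assumes "u \<in> tens.span generators" "v \<in> tens.span generators"
  shows "rbr p u v \<in> lie_closure"
proof -
  have left: "tens.subspace {u. rbr p u v \<in> lie_closure}" for v
  proof (rule tens.subspaceI)
    have "rbr p 0 v = 0" by (simp add: rbr_def fun_eq_iff)
    thus "0 \<in> {u. rbr p u v \<in> lie_closure}"
      using tens.subspace_0[OF subspace_lie_closure] by simp
  qed (auto simp: rbr_add rbr_sc tens.subspace_add[OF subspace_lie_closure]
      tens.subspace_scale[OF subspace_lie_closure])
  have "rbr p u g \<in> lie_closure" if "u \<in> tens.span generators" "g \<in> generators" for u g
    using tens.span_minimal[OF _ left, of generators g] rbr_generators that by blast
  \<comment> \<open>Antisymmetry then moves \<open>v\<close> to the right slot, so that the same
    left-linearity argument covers the other factor.\<close>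
  hence "rbr p v g \<in> lie_closure" if "g \<in> generators" for g using assms(2) that by blast
  hence "rbr p g v \<in> lie_closure" if "g \<in> generators" for g
    unfolding rbr_antisym[of g v] using that tens.subspace_scale[OF subspace_lie_closure] by blast
  thus ?thesis using tens.span_minimal[OF _ left, of generators v] assms(1) by blast
qed

text \<open>The enlarged span is closed under the bracket and contains the two letters, as
  \<open>elC 0\<close> and \<open>elB 0\<close>.\<close>

lemma lie_gen_closure:
  assumes "u \<in> lie_gen p"
  shows "u \<in> lie_closure"
  using assms
proof induction
  case (gen i)
  have "word [1] = elC 0" "word [2] = elB 0" by (simp_all add: elC_eq elB_eq)
  hence "word [i] \<in> generators" using gen by (auto simp: generators_def)
  thus ?case using tens.span_base agree_alternating_refl unfolding lie_closure_def by blast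
next
  case (bracket u v)
  then obtain u' v' where "u' \<in> tens.span generators" "v' \<in> tens.span generators"
    "agree_alternating u u'" "agree_alternating v v'" by (auto simp: lie_closure_def)
  hence "agree_alternating (rbr p u v) (rbr p u' v')" "rbr p u' v' \<in> lie_closure"
    by (auto intro: agree_alternating_rbr rbr_span)
  thus ?case using agree_alternating_trans unfolding lie_closure_def by blast
next
  case (add u v)
  thus ?case using tens.subspace_add[OF subspace_lie_closure, of u v] by (simp add: plus_fun_def)
qed (auto intro: tens.subspace_scale[OF subspace_lie_closure])

lemma tensor_supported_lie_gen: "u \<in> lie_gen p \<Longrightarrow> tensor_supported u"
proof (induction rule: lie_gen.induct)
  case (gen i)
  thus ?case by (auto simp: tensor_supported_def word_def)
next
  case (bracket u v)
  show ?case unfolding tensor_supported_def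
  proof (intro allI impI)
    fix w assume "rbr p u v w \<noteq> 0"
    then obtain k where "u (take k w) * v (drop k w) - v (take k w) * u (drop k w) \<noteq> 0"
      unfolding rbr_def by (auto elim!: sum.not_neutral_contains_not_neutral)
    hence "set (take k w) \<subseteq> {1,2} \<and> set (drop k w) \<subseteq> {1,2}"
      using bracket.IH unfolding tensor_supported_def by force
    thus "set w \<subseteq> {1,2}" by (metis append_take_drop_id set_append Un_least)
  qed
next
  case (add u v)
  thus ?case using tensor_supported_add[of u v] by (simp add: plus_fun_def)
qed (auto intro: tensor_supported_sc)

lemma span_generators:
  assumes "v \<in> tens.span generators"
  shows "tensor_supported v \<and> qsym p v \<in> tens.span (qsym p ` generators)"
proof -
  have "tens.span generators \<subseteq> {v. tensor_supported v \<and> qsym p v \<in> tens.span (qsym p ` generators)}"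
  proof (rule tens.span_minimal)
    show "generators \<subseteq> {v. tensor_supported v \<and> qsym p v \<in> tens.span (qsym p ` generators)}"
      by (auto intro: tens.span_base) (auto simp: generators_def tensor_supported_el)
    show "tens.subspace {v. tensor_supported v \<and> qsym p v \<in> tens.span (qsym p ` generators)}"
      by (intro tens.subspaceI)
        (auto simp: qsym_0 qsym_add qsym_sc tens.span_add tens.span_scale tens.span_zero
          tensor_supported_add tensor_supported_sc, simp add: tensor_supported_def)
  qed
  thus ?thesis using assms by blast
qed

section \<open>Lower bound and equality with the span\<close>

lemma subspace_nichols_lie: "tens.subspace (nichols_lie p)"
proof (rule tens.subspaceI)
  \<comment> \<open>\<open>lie_gen\<close> has no rule for 0, so it is obtained as the zero multiple
    of a generator.\<close>
  have "sc 0 (word [1]) \<in> lie_gen p" by (intro lie_gen.intros) simp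
  moreover have "qsym p (sc 0 (word [1])) = 0" by (simp add: qsym_0)
  ultimately show "0 \<in> nichols_lie p" unfolding nichols_lie_def by (metis imageI)
  show "x + y \<in> nichols_lie p" if "x \<in> nichols_lie p" "y \<in> nichols_lie p" for x y
    using that unfolding nichols_lie_def by (auto simp: qsym_add[symmetric] intro!: imageI lie_gen.add)
  show "sc c x \<in> nichols_lie p" if "x \<in> nichols_lie p" for x c
    using that unfolding nichols_lie_def by (auto simp: qsym_sc[symmetric] intro!: imageI lie_gen.smult)
qed

lemma agree_alternating_sc: "agree_alternating u v \<Longrightarrow> agree_alternating (sc c u) (sc c v)"
  by (simp add: agree_alternating_def sc_def)

lemma sc_sc_inverse: "c \<noteq> 0 \<Longrightarrow> sc (inverse c) (sc c u) = u" for c :: 'a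
  by (simp add: sc_def fun_eq_iff)

lemma lie_gen_base: "elC 0 \<in> lie_gen p" "elB 0 \<in> lie_gen p" "elA p 0 \<in> lie_gen p"
proof -
  show gen: "elC 0 \<in> lie_gen p" "elB 0 \<in> lie_gen p"
    using lie_gen.gen[of 1 p] lie_gen.gen[of 2 p] by (simp_all add: elC_eq elB_eq)
  have "rbr p (elC 0) (elB 0) = elA p 0"
    unfolding rbr_CB by (simp add: sc_def)
  thus "elA p 0 \<in> lie_gen p" using lie_gen.bracket[OF gen] by simp
qed

text \<open>Bracketing with \<open>elA p 0\<close> raises the index of \<open>elC\<close> by one, up
  to a nonzero scalar and words with a repeated letter.\<close>

lemma lie_gen_elC: "\<exists>u\<in>lie_gen p. agree_alternating u (elC k)"
proof (induction k)
  case 0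
  show ?case using lie_gen_base(1) agree_alternating_refl by blast
next
  case (Suc k)
  then obtain u where u: "u \<in> lie_gen p" "agree_alternating u (elC k)" by blast
  \<comment> \<open>The scalar of \<open>rbr_AC\<close> at \<open>j = 0\<close>; characteristic zero
    keeps its factor 2 invertible.\<close>
  define c where "c = 2 * (- q) ^ Suc 0 * q ^ (Suc 0 * k)"
  have "c \<noteq> 0" using p12_nz p21_nz by (simp add: c_def)
  have "agree_alternating (rbr p (elA p 0) u) (sc c (elC (Suc k)))"
    using agree_alternating_trans[OF agree_alternating_rbr[OF agree_alternating_refl u(2)] rbr_AC[of 0 k]]
    by (simp add: c_def)
  hence "agree_alternating (sc (inverse c) (rbr p (elA p 0) u)) (elC (Suc k))"
    using agree_alternating_sc sc_sc_inverse[OF \<open>c \<noteq> 0\<close>] by metis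
  thus ?case using lie_gen.smult[OF lie_gen.bracket[OF lie_gen_base(3) u(1)]] by blast
qed

lemma lie_gen_elB: "\<exists>u\<in>lie_gen p. agree_alternating u (elB k)"
proof (induction k)
  case 0
  show ?case using lie_gen_base(2) agree_alternating_refl by blast
next
  case (Suc k)
  then obtain u where u: "u \<in> lie_gen p" "agree_alternating u (elB k)" by blast
  define c where "c = - (2 * (- q) ^ Suc 0 * q ^ (Suc 0 * k))"
  have "c \<noteq> 0" using p12_nz p21_nz by (simp add: c_def)
  have "agree_alternating (rbr p (elA p 0) u) (sc c (elB (Suc k)))"
    using agree_alternating_trans[OF agree_alternating_rbr[OF agree_alternating_refl u(2)] rbr_AB[of 0 k]]
    by (simp add: c_def)
  hence "agree_alternating (sc (inverse c) (rbr p (elA p 0) u)) (elB (Suc k))"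
    using agree_alternating_sc sc_sc_inverse[OF \<open>c \<noteq> 0\<close>] by metis
  thus ?case using lie_gen.smult[OF lie_gen.bracket[OF lie_gen_base(3) u(1)]] by blast
qed

text \<open>Comes from the bracket of \<open>elC k\<close> with \<open>elB 0\<close>, whose scalar
  is the sign \<open>(-1) ^ k\<close>.\<close>

lemma lie_gen_elA: "\<exists>u\<in>lie_gen p. agree_alternating u (elA p k)"
proof -
  obtain u where u: "u \<in> lie_gen p" "agree_alternating u (elC k)" using lie_gen_elC by blast
  define c where "c = q ^ (k * 0) * (- 1) ^ (k + 0)"
  have "c \<noteq> 0" by (simp add: c_def)
  have "agree_alternating (rbr p u (elB 0)) (sc c (elA p k))"
    using agree_alternating_rbr[OF u(2) agree_alternating_refl, of "elB 0"] unfolding rbr_CB c_def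
    by simp
  hence "agree_alternating (sc (inverse c) (rbr p u (elB 0))) (elA p k)"
    using agree_alternating_sc sc_sc_inverse[OF \<open>c \<noteq> 0\<close>] by metis
  thus ?thesis using lie_gen.smult[OF lie_gen.bracket[OF u(1) lie_gen_base(2)]] by blast
qed

text \<open>Agreement on alternating words becomes equality in the Nichols algebra, so the two
  bounds turn into the two inclusions.\<close>

lemma nichols_lie_eq_span: "nichols_lie p = tens.span (qsym p ` generators)"
proof
  show "nichols_lie p \<subseteq> tens.span (qsym p ` generators)"
  proof
    fix x assume "x \<in> nichols_lie p"
    then obtain u where u: "u \<in> lie_gen p" "x = qsym p u" by (auto simp: nichols_lie_def)
    then obtain v where v: "v \<in> tens.span generators" "agree_alternating u v"
      using lie_gen_closure by (auto simp: lie_closure_def)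
    have "qsym p u = qsym p v"
      by (rule qsym_eqI_alternating[OF tensor_supported_lie_gen[OF u(1)] _ v(2)])
        (use span_generators[OF v(1)] in blast)
    thus "x \<in> tens.span (qsym p ` generators)" using u v span_generators by simp
  qed
  have "qsym p g \<in> nichols_lie p" if "g \<in> generators" for g
  proof -
    have "\<exists>u\<in>lie_gen p. agree_alternating u g"
      using that lie_gen_elA lie_gen_elB lie_gen_elC by (auto simp: generators_def)
    then obtain u where u: "u \<in> lie_gen p" "agree_alternating u g" by blast
    have "tensor_supported g" using that by (auto simp: generators_def tensor_supported_el)
    hence "qsym p u = qsym p g"
      using qsym_eqI_alternating tensor_supported_lie_gen u by blast
    thus ?thesis using u(1) unfolding nichols_lie_def by (metis imageI)
  qed
  thus "tens.span (qsym p ` generators) \<subseteq> nichols_lie p"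
    using subspace_nichols_lie by (intro tens.span_minimal) auto
qed

section \<open>The basis\<close>

definition bidegree :: "nat list \<Rightarrow> nat \<times> nat" where
  "bidegree w = (count (mset w) 1, count (mset w) 2)"

text \<open>Degree of the element with index \<open>(k, t)\<close>, where \<open>t = 0, 1, 2\<close>
  selects \<open>elA\<close>, \<open>elB\<close>, \<open>elC\<close>.\<close>

definition bidegree_of :: "nat \<times> nat \<Rightarrow> nat \<times> nat" where
  "bidegree_of = (\<lambda>(k, t). if t = 0 then (Suc k, Suc k) else if t = 1 then (k, Suc k) else (Suc k, k))"

definition generator :: "nat \<times> nat \<Rightarrow> 'a tens" where
  "generator = (\<lambda>(k, t). if t = 0 then elA p k else if t = 1 then elB k else elC k)"

definition basis_index :: "(nat \<times> nat) set" where
  "basis_index = {i \<in> UNIV \<times> {0,1,2}. qsym p (generator i) \<noteq> 0}"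

lemma bidegree_generator: "generator i w \<noteq> 0 \<Longrightarrow> bidegree w = bidegree_of i"
proof (cases i)
  case (Pair k t)
  assume nz: "generator i w \<noteq> 0"
  hence "w = (if t = 1 then 2 # word12 k else if t \<noteq> 0 then 1 # word21 k else w)"
    "t = 0 \<Longrightarrow> w = word12 (Suc k) \<or> w = word21 (Suc k)"
    by (auto simp: Pair generator_def elA_eq elB_eq elC_eq word_def sc_def
        simp del: replicate_Suc split: if_splits)
  thus ?thesis
    using count_mset_words[of k] count_mset_words[of "Suc k"]
    by (auto simp: Pair bidegree_def bidegree_of_def simp del: replicate_Suc split: if_splits)
qed

lemma bidegree_qsym_generator:
  assumes "qsym p (generator i) w \<noteq> 0"
  shows "bidegree w = bidegree_of i"
proof -
  obtain v where "mset v = mset w" "generator i v \<noteq> 0" using assms by (rule qsym_neq_0D)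
  thus ?thesis using bidegree_generator[of i v] by (simp add: bidegree_def)
qed

text \<open>The difference of the two degrees is 0, -1 or 1, which recovers \<open>t\<close>, and
  then \<open>k\<close>.\<close>

lemma inj_on_bidegree_of: "inj_on bidegree_of (UNIV \<times> {0,1,2})"
  by (auto simp: inj_on_def bidegree_of_def split: if_splits)

text \<open>Each class lives in its own bidegree, so distinct indices give disjoint
  supports.\<close>

lemma qsym_generator_disjoint:
  assumes "i \<in> basis_index" "j \<in> basis_index" "qsym p (generator i) w \<noteq> 0" "qsym p (generator j) w \<noteq> 0"
  shows "i = j"
  using assms inj_on_bidegree_of bidegree_qsym_generator[of _ w]
  unfolding basis_index_def inj_on_def by (metis (no_types, lifting) mem_Collect_eq)

lemma inj_on_basis: "inj_on (\<lambda>i. qsym p (generator i)) basis_index"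
proof (rule inj_onI)
  fix i j assume ij: "i \<in> basis_index" "j \<in> basis_index" "qsym p (generator i) = qsym p (generator j)"
  then obtain w where "qsym p (generator i) w \<noteq> 0" by (auto simp: basis_index_def fun_eq_iff)
  thus "i = j" using qsym_generator_disjoint ij by metis
qed

text \<open>A linear relation is evaluated at a word \<open>w\<close> in the support of one member
  \<open>v\<close>; by disjointness only \<open>c v * v w\<close> remains.\<close>

lemma independent_basis: "\<not> tens.dependent ((\<lambda>i. qsym p (generator i)) ` basis_index)"
proof
  let ?e = "\<lambda>i. qsym p (generator i)"
  assume "tens.dependent (?e ` basis_index)"
  then obtain T c v where T: "finite T" "T \<subseteq> ?e ` basis_index" "(\<Sum>v\<in>T. sc (c v) v) = 0"
    "v \<in> T" "c v \<noteq> 0" unfolding tens.dependent_explicit by blast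
  then obtain i where i: "v = ?e i" "i \<in> basis_index" by blast
  then obtain w where w: "v w \<noteq> 0" by (auto simp: basis_index_def fun_eq_iff)
  have "x w = 0" if "x \<in> T" "x \<noteq> v" for x
    using that T(2) i w qsym_generator_disjoint by blast
  hence "(\<Sum>x\<in>T - {v}. c x * x w) = 0" by (intro sum.neutral) simp
  hence "(\<Sum>x\<in>T. c x * x w) = c v * v w"
    using T(1,4) by (simp add: sum.remove[of T v])
  moreover have "(\<Sum>x\<in>T. sc (c x) x) w = (\<Sum>x\<in>T. c x * x w)"
    using T(1) by (induction T rule: finite_induct) (auto simp: sc_def)
  ultimately show False using T(3,5) w by (simp add: fun_eq_iff)
qed

section \<open>Identification with \<open>P1\<close> and the dimension\<close>

lemma basis_index_iff:
  "(k, t) \<in> basis_index \<longleftrightarrow> t \<in> {0,1,2} \<and> enat k < mord q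
     \<and> \<not> (t = 0 \<and> exceptional p \<and> mord q = enat (Suc k))"
proof -
  have "qsym p (generator (k, t)) = 0 \<longleftrightarrow>
      root_upto k \<or> t = 0 \<and> exceptional p \<and> mord q = enat (Suc k)"
    by (simp add: generator_def qsym_elA_eq_0_iff qsym_elB_eq_0_iff qsym_elC_eq_0_iff)
  thus ?thesis by (simp only: basis_index_def mem_Collect_eq mem_Times_iff fst_conv snd_conv
        UNIV_I simp_thms less_mord_iff de_Morgan_disj)
qed

lemma basis_index_subset: "basis_index \<subseteq> {k. enat k < mord q} \<times> {0,1,2}"
  by (simp only: subset_iff split_paired_All basis_index_iff mem_Times_iff mem_Collect_eq fst_conv snd_conv) blast

lemma qsym_generators: "qsym p ` generators = (\<lambda>i. qsym p (generator i)) ` (UNIV \<times> {0,1,2})"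
proof -
  have "generators = generator ` (UNIV \<times> {0,1,2})"
    by (force simp: generators_def generator_def image_iff)
  thus ?thesis by (simp only: image_image)
qed

lemma basis_eq: "(\<lambda>i. qsym p (generator i)) ` basis_index = qsym p ` generators - {0}"
  unfolding qsym_generators basis_index_def by auto

lemma P1_full_eq: "P1_full p (mord q) = (\<lambda>i. qsym p (generator i)) ` ({k. enat k < mord q} \<times> {0,1,2})"
proof -
  have "(\<Union>k\<in>K. {elA p k, elB k, elC k}) = generator ` (K \<times> {0,1,2})" for K
    by (force simp: generator_def image_iff)
  thus ?thesis by (simp only: P1_full_def image_image)
qed

lemma P1_eq: "P1 p = (\<lambda>i. qsym p (generator i)) ` basis_index"
proof (cases "exceptional p")
  case True
  then obtain k where k: "mord q = enat (Suc k)"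
    unfolding exceptional_def using mord_eq_enatD by blast
  \<comment> \<open>The element taken out of \<open>P1_full\<close> has class 0, so the set
    difference removes exactly 0, as \<open>basis_index\<close> does.\<close>
  have "qsym p (elA p k) = 0" using True k by (simp add: qsym_elA_eq_0_iff)
  hence "P1 p = P1_full p (mord q) - {0}" using True k by (simp add: P1_def Let_def)
  also have "\<dots> = (\<lambda>i. qsym p (generator i)) ` basis_index"
    unfolding P1_full_eq using basis_index_subset by (auto simp: basis_index_def)
  finally show ?thesis .
next
  case False
  hence "basis_index = {k. enat k < mord q} \<times> {0,1,2}"
    by (simp only: set_eq_iff split_paired_All basis_index_iff mem_Times_iff mem_Collect_eq
        fst_conv snd_conv) blast
  thus ?thesis using False by (simp only: P1_def Let_def P1_full_eq if_False)
qed

lemma span_P1: "tens.span (P1 p) = nichols_lie p"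
  by (simp add: P1_eq basis_eq nichols_lie_eq_span)

lemma card_basis_index:
  assumes "mord q = enat m"
  shows "card basis_index = (if exceptional p then 3 * m - 1 else 3 * m)"
proof -
  obtain k where m: "m = Suc k" using mord_eq_enatD[OF assms] by blast
  have "basis_index = {..<m} \<times> {0,1,2} - (if exceptional p then {(k, 0)} else {})"
    by (auto simp: basis_index_iff assms m less_Suc_eq)
  moreover have "card ({..<m} \<times> {0,1,2::nat}) = 3 * m" by (simp add: card_cartesian_product)
  ultimately show ?thesis using m by (simp add: card_Diff_subset)
qed

lemma dim_nichols_lie:
  assumes "mord q = enat m"
  shows "tens.dim (nichols_lie p) = (if exceptional p then 3 * m - 1 else 3 * m)"
proof -
  have "tens.dim (nichols_lie p) = card (P1 p)"
    unfolding span_P1[symmetric] tens.dim_span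
    by (rule tens.dim_eq_card_independent) (simp add: P1_eq independent_basis)
  thus ?thesis by (simp add: P1_eq card_image[OF inj_on_basis] card_basis_index[OF assms])
qed

end

theorem theorem4p3:
  fixes p :: "nat \<Rightarrow> nat \<Rightarrow> 'a::field_char_0"
  assumes nz: "\<And>i j. i \<in> {1,2} \<Longrightarrow> j \<in> {1,2} \<Longrightarrow> p i j \<noteq> 0"
    and diag: "p 1 1 = -1" "p 2 2 = -1"
    and conn: "p 1 2 * p 2 1 \<noteq> 1"
  shows "\<not> module.dependent sc (P1 p)
       \<and> module.span sc (P1 p) = nichols_lie p
       \<and> (\<forall>m. mord (p 1 2 * p 2 1) = enat m \<longrightarrow>
            vector_space.dim sc (nichols_lie p) = (if exceptional p then 3 * m - 1 else 3 * m))"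
proof -
  interpret super_plane p
    by unfold_locales (use nz diag in auto)
  show ?thesis
    using independent_basis span_P1 dim_nichols_lie unfolding P1_eq by blast
qed

end
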